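(* Let $M$ be an oriented minimal Lorentzian surface in $\mathbb S^4_2(1)\subset\mathbb E^5_2$ with Gaussian curvature $K$ and normal curvature $K^D$. If $K$ and $K^D\neq 0$ are constant, then $K=\frac13$ and $|K^D|=\frac23$.
   Context: $\mathbb E^5_2$ is $\mathbb R^5$ with the pseudo-Euclidean metric $\langle\cdot,\cdot\rangle = -dx_1^2-dx_2^2+dx_3^2+dx_4^2+dx_5^2$; $\mathbb S^4_2(1)=\{v\in\mathbb E^5_2:\langle v,v\rangle=1\}$. A Lorentzian surface $M$ in $\mathbb S^4_2(1)$ is a smooth (connected) immersed surface whose induced metric has signature $(-,+)$. $M$ is minimal in $\mathbb S^4_2(1)$ if $\hat H=\frac12\mathrm{tr}\,\hat h=0$, where $\hat h$ is the second fundamental form of $M$ in $\mathbb S^4_2(1)$. The Gaussian curvature is $K=\frac{R(X,Y,Y,X)}{\langle X,X\rangle\langle Y,Y\rangle-\langle X,Y\rangle^2}$ for $X,Y$ spanning the tangent space. The normal curvature is $K^D=-\langle R^{\hat D}(f_1,f_2)f_3,f_4\rangle$, where $R^{\hat D}$ is the curvature tensor of the normal connection $\hat D$ of $M$ in $\mathbb S^4_2(1)$ and $\{f_1,f_2;f_3,f_4\}$ is a local pseudo-orthonormal frame: $f_1,f_2$ tangent, $f_3,f_4$ normal to $M$ in $\mathbb S^4_2(1)$, $\langle f_1,f_2\rangle=\langle f_3,f_4\rangle=-1$, all other products $\langle f_A,f_B\rangle=0$ ($K^D$ is defined up to sign, depending on orientations; the frame is chosen continuously). *)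

theory Defs
  imports "HOL-Analysis.Analysis"
begin

section \<open>Smooth maps and oriented smooth surfaces\<close>

text \<open>Meant for open \<open>S\<close>; on a finite-dimensional domain this is the usual \<open>C\<^sup>k\<close>.\<close>

primrec Ck_on :: "nat \<Rightarrow> 'a::euclidean_space set \<Rightarrow> ('a \<Rightarrow> 'b::real_normed_vector) \<Rightarrow> bool" where
  "Ck_on 0 S f \<longleftrightarrow> continuous_on S f"
| "Ck_on (Suc k) S f \<longleftrightarrow> (\<forall>x\<in>S. f differentiable (at x)) \<and>
     (\<forall>v. Ck_on k S (\<lambda>x. frechet_derivative f (at x) v))"

definition smooth_on :: "'a::euclidean_space set \<Rightarrow> ('a \<Rightarrow> 'b::real_normed_vector) \<Rightarrow> bool" where
  "smooth_on S f \<longleftrightarrow> (\<forall>k. Ck_on k S f)"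

text \<open>Inverse charts: an element \<open>(U, x)\<close> of an atlas is a parametrization \<open>x\<close> of an open part of
  the surface by an open set \<open>U\<close> of the plane. The atlas need not be maximal.\<close>

type_synonym 'm atlas = "((real^2) set \<times> (real^2 \<Rightarrow> 'm)) set"

definition connected_oriented_surface :: "'m topology \<Rightarrow> 'm atlas \<Rightarrow> bool" where
  "connected_oriented_surface M A \<longleftrightarrow>
     topspace M \<noteq> {} \<and> connected_space M \<and> Hausdorff_space M \<and> second_countable M \<and>
     (\<forall>(U, x)\<in>A. open U \<and> openin M (x ` U) \<and>
        homeomorphic_map (top_of_set U) (subtopology M (x ` U)) x) \<and>
     (\<Union>(U, x)\<in>A. x ` U) = topspace M \<and>
     (\<forall>(U, x)\<in>A. \<forall>(V, y)\<in>A.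
        smooth_on {u\<in>U. x u \<in> y ` V} (inv_into V y \<circ> x) \<and>
        (\<forall>u\<in>U. x u \<in> y ` V \<longrightarrow> det (matrix (frechet_derivative (inv_into V y \<circ> x) (at u))) > 0))"

section \<open>Geometry of a parametrized surface in the pseudosphere\<close>

definition pinner :: "real^5 \<Rightarrow> real^5 \<Rightarrow> real" where
  "pinner v w = - v$1 * w$1 - v$2 * w$2 + v$3 * w$3 + v$4 * w$4 + v$5 * w$5"

definition pseudosphere :: "(real^5) set" where
  "pseudosphere = {v. pinner v v = 1}"

text \<open>In the following \<open>X\<close> is a parametrization with values in the pseudosphere. Tangent vectors and
  tangent vector fields of the surface are written in coordinates, i.e. \<open>v :: real^2\<close> at \<open>u\<close>
  stands for the vector \<open>frechet_derivative X (at u) v\<close>.\<close>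

definition first_ff :: "(real^2 \<Rightarrow> real^5) \<Rightarrow> real^2 \<Rightarrow> real^2 \<Rightarrow> real^2 \<Rightarrow> real" where
  "first_ff X u v w = pinner (frechet_derivative X (at u) v) (frechet_derivative X (at u) w)"

text \<open>The Christoffel symbols, as the Koszul formula for constant coordinate fields.\<close>

definition christoffel :: "(real^2 \<Rightarrow> real^5) \<Rightarrow> real^2 \<Rightarrow> real^2 \<Rightarrow> real^2 \<Rightarrow> real^2" where
  "christoffel X u v w = (THE z. \<forall>y. 2 * first_ff X u z y =
       frechet_derivative (\<lambda>u'. first_ff X u' w y) (at u) v
     + frechet_derivative (\<lambda>u'. first_ff X u' v y) (at u) w
     - frechet_derivative (\<lambda>u'. first_ff X u' v w) (at u) y)"

definition levi_civita ::
  "(real^2 \<Rightarrow> real^5) \<Rightarrow> (real^2 \<Rightarrow> real^2) \<Rightarrow> (real^2 \<Rightarrow> real^2) \<Rightarrow> real^2 \<Rightarrow> real^2" where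
  "levi_civita X V W u = frechet_derivative W (at u) (V u) + christoffel X u (V u) (W u)"

definition lie_bracket :: "(real^2 \<Rightarrow> real^2) \<Rightarrow> (real^2 \<Rightarrow> real^2) \<Rightarrow> real^2 \<Rightarrow> real^2" where
  "lie_bracket V W u = frechet_derivative W (at u) (V u) - frechet_derivative V (at u) (W u)"

definition riemann :: "(real^2 \<Rightarrow> real^5) \<Rightarrow> (real^2 \<Rightarrow> real^2) \<Rightarrow> (real^2 \<Rightarrow> real^2) \<Rightarrow>
    (real^2 \<Rightarrow> real^2) \<Rightarrow> real^2 \<Rightarrow> real^2" where
  "riemann X V W Z u = levi_civita X V (levi_civita X W Z) u - levi_civita X W (levi_civita X V Z) u
     - levi_civita X (lie_bracket V W) Z u"

text \<open>\<open>R(v, w, z, y)\<close> at \<open>u\<close>; by tensoriality the vectors may be extended as constant coordinate fields.\<close>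

definition riemann4 ::
  "(real^2 \<Rightarrow> real^5) \<Rightarrow> real^2 \<Rightarrow> real^2 \<Rightarrow> real^2 \<Rightarrow> real^2 \<Rightarrow> real^2 \<Rightarrow> real" where
  "riemann4 X u v w z y = first_ff X u (riemann X (\<lambda>_. v) (\<lambda>_. w) (\<lambda>_. z) u) y"

definition sectional :: "(real^2 \<Rightarrow> real^5) \<Rightarrow> real^2 \<Rightarrow> real^2 \<Rightarrow> real^2 \<Rightarrow> real" where
  "sectional X u v w =
     riemann4 X u v w w v / (first_ff X u v v * first_ff X u w w - (first_ff X u v w)\<^sup>2)"

definition normal_space :: "(real^2 \<Rightarrow> real^5) \<Rightarrow> real^2 \<Rightarrow> (real^5) set" where
  "normal_space X u =
     {\<xi>. pinner \<xi> (X u) = 0 \<and> (\<forall>v. pinner \<xi> (frechet_derivative X (at u) v) = 0)}"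

definition normal_proj :: "(real^2 \<Rightarrow> real^5) \<Rightarrow> real^2 \<Rightarrow> real^5 \<Rightarrow> real^5" where
  "normal_proj X u \<xi> =
     (THE \<eta>. \<eta> \<in> normal_space X u \<and> (\<forall>\<zeta>\<in>normal_space X u. pinner (\<xi> - \<eta>) \<zeta> = 0))"

text \<open>Second fundamental form and normal connection of the surface in the pseudosphere. As the position
  vector is not in \<open>normal_space\<close>, projecting the flat derivative directly gives the same
  result as differentiating in the pseudosphere first.\<close>

definition second_ff :: "(real^2 \<Rightarrow> real^5) \<Rightarrow> real^2 \<Rightarrow> real^2 \<Rightarrow> real^2 \<Rightarrow> real^5" where
  "second_ff X u v w =
     normal_proj X u (frechet_derivative (\<lambda>u'. frechet_derivative X (at u') w) (at u) v)"

definition mean_curvature :: "(real^2 \<Rightarrow> real^5) \<Rightarrow> real^2 \<Rightarrow> real^5" where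
  "mean_curvature X u =
     (let G = (\<chi> i j. first_ff X u (axis i 1) (axis j 1)) :: real^2^2
      in (1/2) *\<^sub>R (\<Sum>i\<in>UNIV. \<Sum>j\<in>UNIV. matrix_inv G $ i $ j *\<^sub>R second_ff X u (axis i 1) (axis j 1)))"

definition normal_conn ::
  "(real^2 \<Rightarrow> real^5) \<Rightarrow> (real^2 \<Rightarrow> real^2) \<Rightarrow> (real^2 \<Rightarrow> real^5) \<Rightarrow> real^2 \<Rightarrow> real^5" where
  "normal_conn X V \<xi> u = normal_proj X u (frechet_derivative \<xi> (at u) (V u))"

definition normal_riemann :: "(real^2 \<Rightarrow> real^5) \<Rightarrow> (real^2 \<Rightarrow> real^2) \<Rightarrow> (real^2 \<Rightarrow> real^2) \<Rightarrow>
    (real^2 \<Rightarrow> real^5) \<Rightarrow> real^2 \<Rightarrow> real^5" where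
  "normal_riemann X V W \<xi> u = normal_conn X V (normal_conn X W \<xi>) u
     - normal_conn X W (normal_conn X V \<xi>) u - normal_conn X (lie_bracket V W) \<xi> u"

definition null_frame :: "(real^2 \<Rightarrow> real^5) \<Rightarrow> (real^2) set \<Rightarrow> (real^2 \<Rightarrow> real^2) \<Rightarrow> (real^2 \<Rightarrow> real^2) \<Rightarrow>
    (real^2 \<Rightarrow> real^5) \<Rightarrow> (real^2 \<Rightarrow> real^5) \<Rightarrow> bool" where
  "null_frame X W f1 f2 f3 f4 \<longleftrightarrow>
     smooth_on W f1 \<and> smooth_on W f2 \<and> smooth_on W f3 \<and> smooth_on W f4 \<and>
     (\<forall>u\<in>W. f3 u \<in> normal_space X u \<and> f4 u \<in> normal_space X u \<and>
        first_ff X u (f1 u) (f1 u) = 0 \<and> first_ff X u (f2 u) (f2 u) = 0 \<and>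
        first_ff X u (f1 u) (f2 u) = -1 \<and>
        pinner (f3 u) (f3 u) = 0 \<and> pinner (f4 u) (f4 u) = 0 \<and> pinner (f3 u) (f4 u) = -1)"

section \<open>Immersed surfaces\<close>

definition lorentzian_immersion :: "'m atlas \<Rightarrow> ('m \<Rightarrow> real^5) \<Rightarrow> bool" where
  "lorentzian_immersion A F \<longleftrightarrow> (\<forall>(U, x)\<in>A.
     smooth_on U (F \<circ> x) \<and>
     (\<forall>u\<in>U. F (x u) \<in> pseudosphere \<and> inj (frechet_derivative (F \<circ> x) (at u)) \<and>
        (\<exists>v w. first_ff (F \<circ> x) u v v = -1 \<and> first_ff (F \<circ> x) u w w = 1 \<and>
               first_ff (F \<circ> x) u v w = 0)))"

definition minimal_surface :: "'m atlas \<Rightarrow> ('m \<Rightarrow> real^5) \<Rightarrow> bool" where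
  "minimal_surface A F \<longleftrightarrow> (\<forall>(U, x)\<in>A. \<forall>u\<in>U. mean_curvature (F \<circ> x) u = 0)"

definition is_gaussian_curvature :: "'m atlas \<Rightarrow> ('m \<Rightarrow> real^5) \<Rightarrow> ('m \<Rightarrow> real) \<Rightarrow> bool" where
  "is_gaussian_curvature A F K \<longleftrightarrow> (\<forall>(U, x)\<in>A. \<forall>u\<in>U. \<forall>v w.
     span {v, w} = UNIV \<longrightarrow> K (x u) = sectional (F \<circ> x) u v w)"

text \<open>The normal curvature depends on the orientation of the frame; \<open>KD\<close> is any function that near
  every point is given by some smooth frame.\<close>

definition is_normal_curvature :: "'m atlas \<Rightarrow> ('m \<Rightarrow> real^5) \<Rightarrow> ('m \<Rightarrow> real) \<Rightarrow> bool" where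
  "is_normal_curvature A F KD \<longleftrightarrow> (\<forall>(U, x)\<in>A. \<forall>u\<in>U.
     \<exists>W f1 f2 f3 f4. open W \<and> u \<in> W \<and> W \<subseteq> U \<and> null_frame (F \<circ> x) W f1 f2 f3 f4 \<and>
       (\<forall>w\<in>W. KD (x w) = - pinner (normal_riemann (F \<circ> x) f1 f2 f3 w) (f4 w)))"

end

theory Submission
  imports Defs
begin

text \<open>
  Write \<open>e1 = dX(f1)\<close>, \<open>e2 = dX(f2)\<close>, let \<open>\<omega> = - <de1, e2>\<close> and \<open>\<phi> = - <df3, f4>\<close> be the connection
  forms of the null frame. Minimality means \<open>h(f1, f2) = 0\<close>, so that \<open>h(f1, f1) = a f3 + b f4\<close> and
  \<open>h(f2, f2) = c f3 + d f4\<close> determine \<open>h\<close>. The Gauss and Ricci equations read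
  \<open>K = 1 + ad + bc = - d\<omega>(f1, f2)\<close> and \<open>K\<^sup>D = ad - bc = d\<phi>(f1, f2)\<close>; hence if both curvatures are constant,
  so are \<open>ad\<close> and \<open>bc\<close>, and they differ. The Codazzi equation gives \<open>da = a (2\<omega> - \<phi>)\<close> in direction \<open>f2\<close>
  and, after exchanging \<open>f1, f2\<close> and \<open>f3, f4\<close>, that the
  differential of \<open>d\<close> is \<open>- d (2\<omega> - \<phi>)\<close> in direction \<open>f1\<close>. If the constant \<open>ad\<close>
  is nonzero, then \<open>da = a (2\<omega> - \<phi>)\<close> in all directions, whence \<open>2 d\<omega> = d\<phi>\<close> and \<open>K\<^sup>D = - 2 K\<close>; likewise
  \<open>K\<^sup>D = 2 K\<close> if \<open>bc\<close> is nonzero. As \<open>K\<^sup>D\<close> does not vanish, exactly one of \<open>ad\<close>, \<open>bc\<close> is zero, so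
  \<open>K = 1 - |K\<^sup>D|\<close> and \<open>|K\<^sup>D| = 2 K\<close>.
\<close>

section \<open>Calculus of smooth maps\<close>

abbreviation dd :: "('a::real_normed_vector \<Rightarrow> 'b::real_normed_vector) \<Rightarrow> 'a \<Rightarrow> 'a \<Rightarrow> 'b" where
  "dd f v u \<equiv> frechet_derivative f (at u) v"

lemma dd_linear:
  assumes "f differentiable at u"
  shows "dd f (v + w) u = dd f v u + dd f w u" "dd f (r *\<^sub>R v) u = r *\<^sub>R dd f v u"
  using linear_frechet_derivative[OF assms] by (simp_all add: linear_add linear_scale)

lemma dd_cong:
  assumes "open S" "u \<in> S" "f differentiable at u" "\<And>u. u \<in> S \<Longrightarrow> f u = g u"
  shows "dd f v u = dd g v u" "g differentiable at u"
proof -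
  show "dd f v u = dd g v u"
    using frechet_derivative_transform_within_open[OF assms(3,1,2), of g] assms(4) by metis
  show "g differentiable at u"
    using has_derivative_transform_within_open[OF _ assms(1,2), of f _ UNIV g] assms(3,4)
    unfolding differentiable_def by blast
qed

context bounded_bilinear begin

lemma has_derivative_dd:
  assumes "f differentiable at u" "g differentiable at u"
  shows "((\<lambda>u. prod (f u) (g u)) has_derivative (\<lambda>v. prod (dd f v u) (g u) + prod (f u) (dd g v u))) (at u)"
  using FDERIV[OF assms[unfolded frechet_derivative_works]]
  by (simp add: add.commute)

lemma dd_prod:
  assumes "f differentiable at u" "g differentiable at u"
  shows "dd (\<lambda>u. prod (f u) (g u)) v u = prod (dd f v u) (g u) + prod (f u) (dd g v u)"
  using frechet_derivative_at[OF has_derivative_dd[OF assms]] by metis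

lemma differentiable_prod:
  assumes "f differentiable at u" "g differentiable at u"
  shows "(\<lambda>u. prod (f u) (g u)) differentiable at u"
  using has_derivative_dd[OF assms] unfolding differentiable_def by blast

end

lemma dd_add:
  assumes "f differentiable at u" "g differentiable at u"
  shows "dd (\<lambda>u. f u + g u) v u = dd f v u + dd g v u"
  using frechet_derivative_at[OF has_derivative_add[OF assms[unfolded frechet_derivative_works]]]
  by metis

lemma dd_minus:
  assumes "f differentiable at u"
  shows "dd (\<lambda>u. - f u) v u = - dd f v u"
  using frechet_derivative_at[OF has_derivative_minus[OF assms[unfolded frechet_derivative_works]]]
  by metis

section \<open>Closure properties of smooth maps\<close>

lemma Ck_on_cong:
  assumes "open S" "\<And>u. u \<in> S \<Longrightarrow> f u = g u" "Ck_on k S f"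
  shows "Ck_on k S g"
  using assms(2,3)
proof (induction k arbitrary: f g)
  case 0
  then show ?case by (simp cong: continuous_on_cong)
next
  case (Suc k)
  have d: "f differentiable at u" if "u \<in> S" for u using Suc.prems(2) that by simp
  have "Ck_on k S (dd g v)" for v
  proof (rule Suc.IH)
    show "dd f v u = dd g v u" if "u \<in> S" for u
      using dd_cong(1)[OF assms(1) that d[OF that] Suc.prems(1)] by simp
    show "Ck_on k S (dd f v)" using Suc.prems(2) by simp
  qed
  moreover have "g differentiable at u" if "u \<in> S" for u
    using dd_cong(2)[OF assms(1) that d[OF that] Suc.prems(1)] by simp
  ultimately show ?case by simp
qed

lemma Ck_on_Suc_imp: "Ck_on (Suc k) S f \<Longrightarrow> Ck_on k S f"
proof (induction k arbitrary: f)
  case 0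
  then show ?case
    by (auto intro!: differentiable_imp_continuous_on differentiable_at_imp_differentiable_on)
next
  case (Suc k)
  then show ?case by (metis Ck_on.simps(2))
qed

lemma Ck_on_const: "Ck_on k S (\<lambda>u. c)"
  by (induction k arbitrary: c) (auto simp: frechet_derivative_const)

lemma Ck_on_add:
  assumes "open S" "Ck_on k S f" "Ck_on k S g"
  shows "Ck_on k S (\<lambda>u. f u + g u)"
  using assms(2,3)
proof (induction k arbitrary: f g)
  case 0
  then show ?case by (simp add: continuous_on_add)
next
  case (Suc k)
  have "Ck_on k S (dd (\<lambda>u. f u + g u) v)" for v
  proof (rule Ck_on_cong[OF assms(1)])
    show "Ck_on k S (\<lambda>u. dd f v u + dd g v u)" using Suc by simp
  qed (use Suc.prems in \<open>simp add: dd_add\<close>)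
  then show ?case using Suc.prems by (simp add: differentiable_add)
qed

text \<open>The product rule leaves factors \<open>f\<close> and \<open>g\<close> undifferentiated,
  so these are first lowered from class \<open>Suc k\<close> to class \<open>k\<close>.\<close>

lemma (in bounded_bilinear) Ck_on_prod:
  assumes "open S" "Ck_on k S f" "Ck_on k S g"
  shows "Ck_on k S (\<lambda>u. prod (f u) (g u))"
  using assms(2,3)
proof (induction k arbitrary: f g)
  case 0
  then show ?case by (simp add: continuous_on)
next
  case (Suc k)
  have "Ck_on k S (dd (\<lambda>u. prod (f u) (g u)) v)" for v
  proof (rule Ck_on_cong[OF assms(1)])
    show "Ck_on k S (\<lambda>u. prod (dd f v u) (g u) + prod (f u) (dd g v u))"
      using Suc Ck_on_Suc_imp[OF Suc.prems(1)] Ck_on_Suc_imp[OF Suc.prems(2)]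
      by (intro Ck_on_add[OF assms(1)]) (simp_all del: Ck_on.simps add: Ck_on.simps(2))
  qed (use Suc.prems in \<open>simp add: dd_prod\<close>)
  then show ?case using Suc.prems by (simp add: differentiable_prod)
qed

lemma Ck_on_subset: "Ck_on k S f \<Longrightarrow> T \<subseteq> S \<Longrightarrow> Ck_on k T f"
  by (induction k arbitrary: f) (auto intro: continuous_on_subset)

lemma smooth_on_subset: "smooth_on S f \<Longrightarrow> T \<subseteq> S \<Longrightarrow> smooth_on T f"
  unfolding smooth_on_def using Ck_on_subset by blast

lemma smooth_on_cong: "open S \<Longrightarrow> (\<And>u. u \<in> S \<Longrightarrow> f u = g u) \<Longrightarrow> smooth_on S f \<Longrightarrow> smooth_on S g"
  unfolding smooth_on_def using Ck_on_cong by blast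

lemma smooth_on_differentiable: "smooth_on S f \<Longrightarrow> u \<in> S \<Longrightarrow> f differentiable at u"
  unfolding smooth_on_def by (metis Ck_on.simps(2))

lemma smooth_on_dd: "smooth_on S f \<Longrightarrow> smooth_on S (dd f v)"
  unfolding smooth_on_def by (metis Ck_on.simps(2))

lemma smooth_on_continuous: "smooth_on S f \<Longrightarrow> continuous_on S f"
  unfolding smooth_on_def by (metis Ck_on.simps(1))

lemma smooth_on_const: "smooth_on S (\<lambda>u. c)"
  unfolding smooth_on_def by (simp add: Ck_on_const)

lemma smooth_on_add: "open S \<Longrightarrow> smooth_on S f \<Longrightarrow> smooth_on S g \<Longrightarrow> smooth_on S (\<lambda>u. f u + g u)"
  unfolding smooth_on_def by (simp add: Ck_on_add)

lemma (in bounded_bilinear) smooth_on_prod: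
  "open S \<Longrightarrow> smooth_on S f \<Longrightarrow> smooth_on S g \<Longrightarrow> smooth_on S (\<lambda>u. prod (f u) (g u))"
  unfolding smooth_on_def by (simp add: Ck_on_prod)

lemma smooth_on_inner:
  "open S \<Longrightarrow> smooth_on S f \<Longrightarrow> smooth_on S g \<Longrightarrow> smooth_on S (\<lambda>u. f u \<bullet> g u)"
  by (rule bounded_bilinear.smooth_on_prod[OF bounded_bilinear_inner])

lemma smooth_on_scaleR:
  "open S \<Longrightarrow> smooth_on S f \<Longrightarrow> smooth_on S g \<Longrightarrow> smooth_on S (\<lambda>u. f u *\<^sub>R g u)"
  by (rule bounded_bilinear.smooth_on_prod[OF bounded_bilinear_scaleR])

lemma smooth_on_minus: "open S \<Longrightarrow> smooth_on S f \<Longrightarrow> smooth_on S (\<lambda>u. - f u)"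
  using smooth_on_scaleR[OF _ smooth_on_const, of S f "-1"] by simp

text \<open>Two applications of the mean value theorem to the second difference of \<open>f\<close> on the parallelogram
  spanned by \<open>h v\<close> and \<open>h w\<close>.\<close>

lemma second_difference_mvt:
  fixes f :: "'a::euclidean_space \<Rightarrow> real"
  assumes sm: "smooth_on S f" and h: "h > 0"
    and S: "\<And>s t. \<lbrakk>0 \<le> s; s \<le> h; 0 \<le> t; t \<le> h\<rbrakk> \<Longrightarrow> x + s *\<^sub>R v + t *\<^sub>R w \<in> S"
  obtains s t where "0 \<le> s" "s \<le> h" "0 \<le> t" "t \<le> h"
    "f (x + h *\<^sub>R v + h *\<^sub>R w) - f (x + h *\<^sub>R v) - f (x + h *\<^sub>R w) + f x
      = h\<^sup>2 * dd (dd f v) w (x + s *\<^sub>R v + t *\<^sub>R w)"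
proof -
  have D: "((\<lambda>s. g (y + s *\<^sub>R z)) has_derivative (\<lambda>r. r * dd g z (y + s *\<^sub>R z))) (at s within T)"
    if "smooth_on S g" "y + s *\<^sub>R z \<in> S" for g :: "'a \<Rightarrow> real" and y z s T
  proof -
    have g: "(g has_derivative (\<lambda>z'. dd g z' (y + s *\<^sub>R z))) (at (y + s *\<^sub>R z))"
      using smooth_on_differentiable[OF that] by (simp add: frechet_derivative_works)
    have "((\<lambda>s. g (y + s *\<^sub>R z)) has_derivative (\<lambda>r. dd g (r *\<^sub>R z) (y + s *\<^sub>R z))) (at s within T)"
      by (rule has_derivative_compose[where f = "\<lambda>s. y + s *\<^sub>R z", OF _ g])
        (auto intro!: derivative_eq_intros)
    then show ?thesis
      using dd_linear(2)[OF smooth_on_differentiable[OF that]] by simp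
  qed
  \<comment> \<open>The second difference is the increment of this function from 0 to
    \<open>h\<close>; the mean value theorem is applied first in direction \<open>v\<close>, then in
    direction \<open>w\<close>.\<close>
  let ?\<phi> = "\<lambda>s. f ((x + h *\<^sub>R w) + s *\<^sub>R v) - f (x + s *\<^sub>R v)"
  have "\<exists>s\<in>{0<..<h}. ?\<phi> h - ?\<phi> 0 =
      (h - 0) * dd f v ((x + h *\<^sub>R w) + s *\<^sub>R v) - (h - 0) * dd f v (x + s *\<^sub>R v)"
  proof (rule mvt_simple[OF h])
    fix s :: real assume s: "0 \<le> s" "s \<le> h"
    have "x + h *\<^sub>R w + s *\<^sub>R v \<in> S" "x + s *\<^sub>R v \<in> S"
      using S[of s h] S[of s 0] s h by (simp_all add: ac_simps)
    then show "(?\<phi> has_derivative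
        (\<lambda>r. r * dd f v ((x + h *\<^sub>R w) + s *\<^sub>R v) - r * dd f v (x + s *\<^sub>R v))) (at s within {0..h})"
      by (intro has_derivative_diff D[OF sm])
  qed
  then obtain s where s: "0 < s" "s < h"
    and \<phi>: "?\<phi> h - ?\<phi> 0 = h * (dd f v ((x + s *\<^sub>R v) + h *\<^sub>R w) - dd f v (x + s *\<^sub>R v + 0 *\<^sub>R w))"
    by (auto simp: algebra_simps)
  have "\<exists>t\<in>{0<..<h}. dd f v ((x + s *\<^sub>R v) + h *\<^sub>R w) - dd f v ((x + s *\<^sub>R v) + 0 *\<^sub>R w)
      = (h - 0) * dd (dd f v) w ((x + s *\<^sub>R v) + t *\<^sub>R w)"
  proof (rule mvt_simple[OF h])
    fix t :: real assume t: "0 \<le> t" "t \<le> h"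
    show "((\<lambda>t. dd f v ((x + s *\<^sub>R v) + t *\<^sub>R w)) has_derivative
        (\<lambda>r. r * dd (dd f v) w ((x + s *\<^sub>R v) + t *\<^sub>R w))) (at t within {0..h})"
      by (rule D[OF smooth_on_dd[OF sm]]) (use S s t in simp)
  qed
  then obtain t where t: "0 < t" "t < h"
    and \<psi>: "dd f v ((x + s *\<^sub>R v) + h *\<^sub>R w) - dd f v ((x + s *\<^sub>R v) + 0 *\<^sub>R w)
      = h * dd (dd f v) w ((x + s *\<^sub>R v) + t *\<^sub>R w)"
    by auto
  show thesis
  proof (rule that)
    show "f (x + h *\<^sub>R v + h *\<^sub>R w) - f (x + h *\<^sub>R v) - f (x + h *\<^sub>R w) + f x
      = h\<^sup>2 * dd (dd f v) w (x + s *\<^sub>R v + t *\<^sub>R w)"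
      using \<phi>[unfolded \<psi>] by (simp add: power2_eq_square algebra_simps)
  qed (use s t in auto)
qed

text \<open>Schwarz's theorem: the second difference is symmetric in \<open>v\<close> and
  \<open>w\<close> and is \<open>h\<^sup>2\<close> times either mixed derivative at some point of a
  small parallelogram. Continuity forces equality at \<open>x\<close>.\<close>

lemma dd_commute_real:
  fixes f :: "'a::euclidean_space \<Rightarrow> real"
  assumes "open S" and sm: "smooth_on S f" and x: "x \<in> S"
  shows "dd (dd f v) w x = dd (dd f w) v x"
proof (rule ccontr)
  assume ne: "dd (dd f v) w x \<noteq> dd (dd f w) v x"
  \<comment> \<open>Half of the gap, so that no number is at distance less than \<open>e\<close>
    from both mixed derivatives.\<close>
  define e where "e = \<bar>dd (dd f v) w x - dd (dd f w) v x\<bar> / 2"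
  have e: "e > 0" using ne by (simp add: e_def)
  have cont: "continuous (at x) (dd (dd f v) w)" for v w
    using smooth_on_continuous[OF smooth_on_dd[OF smooth_on_dd[OF sm]]] assms(1) x
    by (simp add: continuous_on_eq_continuous_at)
  have "\<exists>d>0. \<forall>y. dist y x < d \<longrightarrow> dist (dd (dd f v) w y) (dd (dd f v) w x) < e" for v w
    using cont[of v w] e by (auto simp: continuous_at_eps_delta)
  then obtain d1 d2 where d1: "d1 > 0" "\<And>y. dist y x < d1 \<Longrightarrow> dist (dd (dd f v) w y) (dd (dd f v) w x) < e"
    and d2: "d2 > 0" "\<And>y. dist y x < d2 \<Longrightarrow> dist (dd (dd f w) v y) (dd (dd f w) v x) < e"
    by metis
  obtain d3 where d3: "d3 > 0" "ball x d3 \<subseteq> S" using assms(1) x openE by blast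
  define d where "d = min d1 (min d2 d3)"
  \<comment> \<open>Keeps the parallelogram inside the ball of radius \<open>d\<close>; the added 1
    makes the denominator positive even if \<open>v\<close> and \<open>w\<close> vanish.\<close>
  define h where "h = d / (2 * (norm v + norm w + 1))"
  have d: "d > 0" using d1 d2 d3 by (simp add: d_def)
  have pos: "norm v + norm w + 1 > 0" by (simp add: add_nonneg_pos)
  have h: "h > 0" using d pos by (simp add: h_def)
  have near: "dist (x + s *\<^sub>R v' + t *\<^sub>R w') x < d"
    if "0 \<le> s" "s \<le> h" "0 \<le> t" "t \<le> h" "{v', w'} = {v, w}" for s t v' w'
  proof -
    have "norm (s *\<^sub>R v' + t *\<^sub>R w') \<le> s * norm v' + t * norm w'"
      using norm_triangle_ineq[of "s *\<^sub>R v'" "t *\<^sub>R w'"] that by simp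
    also have "\<dots> \<le> h * norm v' + h * norm w'"
      using that by (intro add_mono mult_right_mono) auto
    also have "\<dots> = h * (norm v + norm w)"
      using that(5) by (auto simp: doubleton_eq_iff algebra_simps)
    also have "\<dots> < h * (2 * (norm v + norm w + 1))"
      using h norm_ge_zero[of v] norm_ge_zero[of w]
      by (intro mult_strict_left_mono) (simp_all add: add_nonneg_pos del: norm_ge_zero)
    also have "\<dots> = d" using pos by (simp add: h_def)
    finally show ?thesis by (simp add: dist_norm add.assoc)
  qed
  have S: "x + s *\<^sub>R v' + t *\<^sub>R w' \<in> S" if "0 \<le> s" "s \<le> h" "0 \<le> t" "t \<le> h" "{v', w'} = {v, w}" for s t v' w'
    using near[OF that] d3(2) by (auto simp: d_def dist_commute)
  obtain s t where st: "0 \<le> s" "s \<le> h" "0 \<le> t" "t \<le> h"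
    "f (x + h *\<^sub>R v + h *\<^sub>R w) - f (x + h *\<^sub>R v) - f (x + h *\<^sub>R w) + f x
      = h\<^sup>2 * dd (dd f v) w (x + s *\<^sub>R v + t *\<^sub>R w)"
    using second_difference_mvt[OF sm h S] by blast
  have S': "x + s *\<^sub>R w + t *\<^sub>R v \<in> S" if "0 \<le> s" "s \<le> h" "0 \<le> t" "t \<le> h" for s t
    using S[OF that, of w v] by auto
  obtain s' t' where st': "0 \<le> s'" "s' \<le> h" "0 \<le> t'" "t' \<le> h"
    "f (x + h *\<^sub>R w + h *\<^sub>R v) - f (x + h *\<^sub>R w) - f (x + h *\<^sub>R v) + f x
      = h\<^sup>2 * dd (dd f w) v (x + s' *\<^sub>R w + t' *\<^sub>R v)"
    using second_difference_mvt[OF sm h S'] by blast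
  have "h\<^sup>2 * dd (dd f v) w (x + s *\<^sub>R v + t *\<^sub>R w) = h\<^sup>2 * dd (dd f w) v (x + s' *\<^sub>R w + t' *\<^sub>R v)"
    unfolding st(5)[symmetric] st'(5)[symmetric] by (simp add: ac_simps)
  then have "dd (dd f v) w (x + s *\<^sub>R v + t *\<^sub>R w) = dd (dd f w) v (x + s' *\<^sub>R w + t' *\<^sub>R v)"
    using h by simp
  moreover have "dist (dd (dd f v) w (x + s *\<^sub>R v + t *\<^sub>R w)) (dd (dd f v) w x) < e"
    using d1(2) near[OF st(1-4)] by (simp add: d_def)
  moreover have "dist (dd (dd f w) v (x + s' *\<^sub>R w + t' *\<^sub>R v)) (dd (dd f w) v x) < e"
    using d2(2) near[OF st'(1-4), of w v] by (auto simp: d_def)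
  ultimately show False by (auto simp: e_def dist_real_def abs_if split: if_splits)
qed

lemma dd_inner_const:
  assumes "f differentiable at u"
  shows "dd (\<lambda>u. f u \<bullet> b) v u = dd f v u \<bullet> b"
  using bounded_bilinear.dd_prod[OF bounded_bilinear_inner assms differentiable_const, of b v] by simp

lemma dd_commute:
  fixes f :: "'a::euclidean_space \<Rightarrow> 'b::real_inner"
  assumes "open S" and sm: "smooth_on S f" and x: "x \<in> S"
  shows "dd (dd f v) w x = dd (dd f w) v x"
proof -
  have "dd (dd f v) w x \<bullet> b = dd (dd f w) v x \<bullet> b" for b
  proof -
    have sb: "smooth_on S (\<lambda>u. f u \<bullet> b)" by (intro smooth_on_inner assms smooth_on_const)
    have "dd (dd f v) w x \<bullet> b = dd (dd (\<lambda>u. f u \<bullet> b) v) w x" for v w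
    proof -
      have "dd (dd f v) w x \<bullet> b = dd (\<lambda>u. dd f v u \<bullet> b) w x"
        by (simp add: dd_inner_const smooth_on_differentiable[OF smooth_on_dd[OF sm] x])
      also have "\<dots> = dd (dd (\<lambda>u. f u \<bullet> b) v) w x"
        by (rule dd_cong(1)[OF assms(1) x])
          (use smooth_on_differentiable[OF smooth_on_inner[OF assms(1) smooth_on_dd[OF sm] smooth_on_const] x]
            in \<open>auto simp: dd_inner_const smooth_on_differentiable[OF sm]\<close>)
      finally show ?thesis .
    qed
    then show ?thesis using dd_commute_real[OF assms(1) sb x] by simp
  qed
  then show ?thesis by (metis vector_eq_rdot)
qed

section \<open>Derivatives in a direction that varies with the point\<close>

lemma dd_sum:
  assumes "\<And>i. i \<in> I \<Longrightarrow> g i differentiable at u"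
  shows "dd (\<lambda>u. \<Sum>i\<in>I. g i u) v u = (\<Sum>i\<in>I. dd (g i) v u)"
  using frechet_derivative_at[OF has_derivative_sum[of I g "\<lambda>i v. dd (g i) v u" "at u"]] assms
  by (metis frechet_derivative_works)

lemma dd_scaleR:
  assumes "f differentiable at u" "g differentiable at u"
  shows "dd (\<lambda>u. f u *\<^sub>R g u) v u = dd f v u *\<^sub>R g u + f u *\<^sub>R dd g v u"
  by (rule bounded_bilinear.dd_prod[OF bounded_bilinear_scaleR assms])

lemma dd_mult:
  fixes f g :: "'a::real_normed_vector \<Rightarrow> real"
  assumes "f differentiable at u" "g differentiable at u"
  shows "dd (\<lambda>u. f u * g u) v u = dd f v u * g u + f u * dd g v u"
  by (rule bounded_bilinear.dd_prod[OF bounded_bilinear_mult assms])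

lemma smooth_on_sum:
  assumes "open S" "finite I" "\<And>i. i \<in> I \<Longrightarrow> smooth_on S (f i)"
  shows "smooth_on S (\<lambda>u. \<Sum>i\<in>I. f i u)"
  using assms(2,3)
  by (induction I rule: finite_induct) (auto intro!: smooth_on_add smooth_on_const assms(1))

text \<open>For a parametrization \<open>X\<close> this is the tangent field with coordinates
  \<open>f\<close>, seen as a vector field in the ambient space.\<close>

definition along :: "('a::real_normed_vector \<Rightarrow> 'b::real_normed_vector) \<Rightarrow> ('a \<Rightarrow> 'a) \<Rightarrow> 'a \<Rightarrow> 'b" where
  "along Y f u = dd Y (f u) u"

lemma dd_Basis_sum:
  fixes Y :: "'a::euclidean_space \<Rightarrow> 'b::real_normed_vector"
  assumes "Y differentiable at u"
  shows "dd Y v u = (\<Sum>b\<in>Basis. (v \<bullet> b) *\<^sub>R dd Y b u)"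
proof -
  have "dd Y v u = dd Y (\<Sum>b\<in>Basis. (v \<bullet> b) *\<^sub>R b) u" by (simp only: euclidean_representation)
  then show ?thesis
    using linear_frechet_derivative[OF assms] by (simp only: linear_sum linear_scale)
qed

text \<open>Smoothness is available for derivatives in constant directions; splitting
  \<open>f\<close> along the fixed basis transfers it to \<open>along\<close>.\<close>

lemma along_Basis_sum:
  fixes Y :: "'a::euclidean_space \<Rightarrow> 'b::real_normed_vector"
  assumes "smooth_on S Y" "u \<in> S"
  shows "(\<Sum>b\<in>Basis. (f u \<bullet> b) *\<^sub>R dd Y b u) = along Y f u"
  unfolding along_def by (rule dd_Basis_sum[OF smooth_on_differentiable[OF assms], symmetric])

lemma smooth_on_along:
  assumes "open S" "smooth_on S Y" "smooth_on S f"
  shows "smooth_on S (along Y f)"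
  by (rule smooth_on_cong[OF assms(1) along_Basis_sum[OF assms(2)]])
    (auto intro!: smooth_on_sum smooth_on_scaleR smooth_on_inner smooth_on_dd smooth_on_const assms)

text \<open>The product rule: either the direction \<open>f\<close> is differentiated, or
  \<open>f u\<close> is frozen and \<open>Y\<close> is differentiated twice.\<close>

lemma dd_along:
  fixes Y :: "'a::euclidean_space \<Rightarrow> 'b::real_inner"
  assumes S: "open S" "u \<in> S" and Y: "smooth_on S Y" and f: "smooth_on S f"
  shows "dd (along Y f) w u = dd Y (dd f w u) u + dd (dd Y (f u)) w u"
proof -
  note diff = smooth_on_differentiable[OF _ S(2)]
  note smooth = smooth_on_scaleR smooth_on_inner smooth_on_dd smooth_on_const S f Y
  have "dd (along Y f) w u = dd (\<lambda>u. \<Sum>b\<in>Basis. (f u \<bullet> b) *\<^sub>R dd Y b u) w u"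
    by (rule sym, rule dd_cong(1)[OF S _ along_Basis_sum[OF Y]])
      (auto intro!: diff smooth_on_sum smooth)
  also have "\<dots> = (\<Sum>b\<in>Basis. dd (\<lambda>u. (f u \<bullet> b) *\<^sub>R dd Y b u) w u)"
    by (rule dd_sum) (auto intro!: diff smooth)
  also have "\<dots> = (\<Sum>b\<in>Basis. (dd f w u \<bullet> b) *\<^sub>R dd Y b u) + (\<Sum>b\<in>Basis. (f u \<bullet> b) *\<^sub>R dd (dd Y b) w u)"
    unfolding sum.distrib[symmetric]
    by (rule sum.cong[OF refl], subst dd_scaleR)
      (auto intro!: diff smooth simp: dd_inner_const[OF diff[OF f]])
  also have "(\<Sum>b\<in>Basis. (dd f w u \<bullet> b) *\<^sub>R dd Y b u) = dd Y (dd f w u) u"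
    by (rule dd_Basis_sum[symmetric, OF diff[OF Y]])
  also have "(\<Sum>b\<in>Basis. (f u \<bullet> b) *\<^sub>R dd (dd Y b) w u) = dd (dd Y w) (f u) u"
    by (subst dd_commute[OF S(1) Y S(2)]) (rule dd_Basis_sum[symmetric, OF diff[OF smooth_on_dd[OF Y]]])
  also have "\<dots> = dd (dd Y (f u)) w u"
    by (rule dd_commute[OF S(1) Y S(2)])
  finally show ?thesis .
qed

section \<open>Moving frames\<close>

lemma pinner_commute: "pinner v w = pinner w v"
  by (simp add: pinner_def)

lemma bilinear_pinner: "bilinear pinner"
  unfolding bilinear_def
  by (auto intro!: linearI simp: pinner_def algebra_simps)

interpretation pinner: bounded_bilinear pinner
  using bilinear_pinner by (simp add: bilinear_conv_bounded_bilinear)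

lemmas pinner_simps =
  pinner.add_left pinner.add_right pinner.diff_left pinner.diff_right pinner.minus_left pinner.minus_right
  pinner.scaleR_left pinner.scaleR_right pinner.zero_left pinner.zero_right

lemma exhaust_5: "x = 1 \<or> x = 2 \<or> x = 3 \<or> x = 4 \<or> x = 5" for x :: 5
proof (induct x)
  case (of_int z)
  then have "0 \<le> z" "z < 5" by simp_all
  then have "z = 0 \<or> z = 1 \<or> z = 2 \<or> z = 3 \<or> z = 4" by arith
  then show ?case by auto
qed

text \<open>In a null pair the coefficient of one vector is minus the product with the other. As
  products recover all coefficients, the coefficient map \<open>T\<close> is injective, hence
  surjective by dimension.\<close>

lemma pinner_frame_expansion:
  assumes "pinner x x = 1" "pinner x a = 0" "pinner x b = 0" "pinner x c = 0" "pinner x d = 0"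
    and "pinner a a = 0" "pinner b b = 0" "pinner a b = -1"
    and "pinner c c = 0" "pinner d d = 0" "pinner c d = -1"
    and "pinner a c = 0" "pinner a d = 0" "pinner b c = 0" "pinner b d = 0"
  shows "z = pinner z x *\<^sub>R x - pinner z b *\<^sub>R a - pinner z a *\<^sub>R b - pinner z d *\<^sub>R c - pinner z c *\<^sub>R d"
proof -
  have sym: "pinner a x = 0" "pinner b x = 0" "pinner c x = 0" "pinner d x = 0" "pinner b a = -1"
    "pinner d c = -1" "pinner c a = 0" "pinner d a = 0" "pinner c b = 0" "pinner d b = 0"
    using assms by (metis pinner_commute)+
  define T where "T k = k$1 *\<^sub>R x + k$2 *\<^sub>R a + k$3 *\<^sub>R b + k$4 *\<^sub>R c + k$5 *\<^sub>R d" for k :: "real^5"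
  have T: "pinner (T k) x = k$1" "pinner (T k) b = - k$2" "pinner (T k) a = - k$3"
    "pinner (T k) d = - k$4" "pinner (T k) c = - k$5" for k
    by (simp_all add: T_def pinner_simps assms sym)
  have "linear T"
    by (intro linearI) (simp_all add: T_def algebra_simps)
  moreover have "inj T"
  proof (rule injI)
    fix k l assume eq: "T k = T l"
    have "k$1 = l$1" "k$2 = l$2" "k$3 = l$3" "k$4 = l$4" "k$5 = l$5"
      using T[of k, unfolded eq] T[of l] by simp_all
    then have "k$i = l$i" for i using exhaust_5[of i] by auto
    then show "k = l" by (simp add: vec_eq_iff)
  qed
  ultimately have "surj T" by (rule linear_injective_imp_surjective) simp
  then obtain k where "z = T k" by (metis surjD)
  then show ?thesis using T[of k] by (simp add: T_def)
qed

section \<open>Connection forms and their exterior derivatives\<close>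

lemma dd_pinner:
  assumes "f differentiable at u" "g differentiable at u"
  shows "dd (\<lambda>u. pinner (f u) (g u)) v u = pinner (dd f v u) (g u) + pinner (f u) (dd g v u)"
  by (rule pinner.dd_prod[OF assms])

lemma pinner_dd_const:
  assumes S: "open S" "u \<in> S" and f: "smooth_on S f" and g: "smooth_on S g"
    and c: "\<And>u. u \<in> S \<Longrightarrow> pinner (f u) (g u) = c"
  shows "pinner (dd f v u) (g u) = - pinner (f u) (dd g v u)"
proof -
  have "0 = dd (\<lambda>u. pinner (f u) (g u)) v u"
    using dd_cong(1)[OF S differentiable_const, of c "\<lambda>u. pinner (f u) (g u)" v] c by simp
  also have "\<dots> = pinner (dd f v u) (g u) + pinner (f u) (dd g v u)"
    by (intro dd_pinner smooth_on_differentiable[OF _ S(2)] f g)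
  finally show ?thesis by simp
qed

text \<open>For a null pair \<open>e\<close>, \<open>e'\<close> of the frame the sign makes this the
  component of the derivative of \<open>e\<close> along \<open>e\<close>. The direction precedes the
  point so that \<open>conn_form e e' v\<close> can be differentiated.\<close>

definition conn_form :: "(real^2 \<Rightarrow> real^5) \<Rightarrow> (real^2 \<Rightarrow> real^5) \<Rightarrow> real^2 \<Rightarrow> real^2 \<Rightarrow> real" where
  "conn_form e e' v u = - pinner (dd e v u) (e' u)"

lemma pinner_dd: "pinner (dd e v u) (e' u) = - conn_form e e' v u"
  by (simp add: conn_form_def)

lemma conn_form_linear:
  assumes "smooth_on S e" "u \<in> S"
  shows "conn_form e e' (v + w) u = conn_form e e' v u + conn_form e e' w u"
    "conn_form e e' (r *\<^sub>R v) u = r * conn_form e e' v u"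
  by (simp_all add: conn_form_def dd_linear[OF smooth_on_differentiable[OF assms]] pinner_simps)

lemma smooth_on_conn_form:
  "open S \<Longrightarrow> smooth_on S e \<Longrightarrow> smooth_on S e' \<Longrightarrow> smooth_on S (conn_form e e' v)"
  unfolding conn_form_def by (intro smooth_on_minus pinner.smooth_on_prod smooth_on_dd)

text \<open>The left side is the exterior derivative on the constant fields \<open>v\<close>,
  \<open>w\<close>, whose bracket vanishes. Second derivatives of \<open>e\<close> cancel by
  symmetry.\<close>

lemma d_conn_form:
  assumes S: "open S" "u \<in> S" and e: "smooth_on S e" and e': "smooth_on S e'"
  shows "dd (conn_form e e' w) v u - dd (conn_form e e' v) w u
    = pinner (dd e v u) (dd e' w u) - pinner (dd e w u) (dd e' v u)"
proof -
  note diff = smooth_on_differentiable[OF _ S(2)]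
  have "dd (conn_form e e' w) v u = - pinner (dd (dd e w) v u) (e' u) - pinner (dd e w u) (dd e' v u)" for v w
    unfolding conn_form_def
    by (subst dd_minus) (auto simp: dd_pinner diff smooth_on_dd e e' intro!: diff pinner.smooth_on_prod S)
  then show ?thesis
    by (simp add: dd_commute[OF S(1) e S(2), of w v])
qed

section \<open>Adapted null frames on a minimal surface\<close>

locale minimal_null_frame =
  fixes X :: "real^2 \<Rightarrow> real^5" and W f1 f2 f3 f4
  assumes open_W: "open W" and smooth_X: "smooth_on W X"
    and sphere: "\<And>u. u \<in> W \<Longrightarrow> pinner (X u) (X u) = 1"
    and frame: "null_frame X W f1 f2 f3 f4"
    and minimal: "\<And>u. u \<in> W \<Longrightarrow> mean_curvature X u = 0"
begin

text \<open>The assumptions are symmetric within each null pair; exchanging its members turns every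
  equation proved here into its mirror image.\<close>

lemma swap_tangent: "minimal_null_frame X W f2 f1 f3 f4"
  using frame by unfold_locales
    (auto simp: open_W smooth_X sphere minimal null_frame_def first_ff_def pinner_commute)

lemma swap_normal: "minimal_null_frame X W f1 f2 f4 f3"
  using frame by unfold_locales
    (auto simp: open_W smooth_X sphere minimal null_frame_def pinner_commute)

abbreviation "e1 \<equiv> along X f1"
abbreviation "e2 \<equiv> along X f2"

lemma smooth: "smooth_on W f1" "smooth_on W f2" "smooth_on W f3" "smooth_on W f4"
  "smooth_on W e1" "smooth_on W e2"
  using frame smooth_on_along[OF open_W smooth_X] by (auto simp: null_frame_def)

lemmas diff = smooth_on_differentiable[of W]

lemma dX_orth: "u \<in> W \<Longrightarrow> pinner (dd X v u) (X u) = 0"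
  using pinner_dd_const[OF open_W _ smooth_X smooth_X sphere, of u v]
  by (simp add: pinner_commute)

lemma dX_normal:
  assumes "u \<in> W"
  shows "pinner (dd X v u) (f3 u) = 0" "pinner (dd X v u) (f4 u) = 0"
    "pinner (X u) (f3 u) = 0" "pinner (X u) (f4 u) = 0"
  using frame assms by (auto simp: null_frame_def normal_space_def pinner_commute)

lemma gram0:
  assumes "u \<in> W"
  shows "pinner (X u) (X u) = 1" "pinner (X u) (e1 u) = 0" "pinner (X u) (e2 u) = 0"
    "pinner (X u) (f3 u) = 0" "pinner (X u) (f4 u) = 0"
    "pinner (e1 u) (e1 u) = 0" "pinner (e2 u) (e2 u) = 0" "pinner (e1 u) (e2 u) = -1"
    "pinner (f3 u) (f3 u) = 0" "pinner (f4 u) (f4 u) = 0" "pinner (f3 u) (f4 u) = -1"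
    "pinner (e1 u) (f3 u) = 0" "pinner (e1 u) (f4 u) = 0" "pinner (e2 u) (f3 u) = 0" "pinner (e2 u) (f4 u) = 0"
  using frame dX_orth[OF assms] dX_normal[OF assms] sphere[OF assms] assms
  by (auto simp: null_frame_def first_ff_def along_def pinner_commute)

lemma gram1:
  assumes "u \<in> W"
  shows "pinner (e1 u) (X u) = 0" "pinner (e2 u) (X u) = 0"
    "pinner (f3 u) (X u) = 0" "pinner (f4 u) (X u) = 0"
    "pinner (e2 u) (e1 u) = -1" "pinner (f4 u) (f3 u) = -1"
    "pinner (f3 u) (e1 u) = 0" "pinner (f4 u) (e1 u) = 0" "pinner (f3 u) (e2 u) = 0" "pinner (f4 u) (e2 u) = 0"
  using gram0[OF assms] by (metis pinner_commute)+

lemmas gram = gram0 gram1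

lemma frame_expansion:
  assumes "u \<in> W"
  shows "z = pinner z (X u) *\<^sub>R X u - pinner z (e2 u) *\<^sub>R e1 u - pinner z (e1 u) *\<^sub>R e2 u
    - pinner z (f4 u) *\<^sub>R f3 u - pinner z (f3 u) *\<^sub>R f4 u"
  by (rule pinner_frame_expansion) (simp_all add: gram0[OF assms])

lemma pinner_frame:
  assumes "u \<in> W"
  shows "pinner z y = pinner z (X u) * pinner y (X u)
    - pinner z (e2 u) * pinner y (e1 u) - pinner z (e1 u) * pinner y (e2 u)
    - pinner z (f4 u) * pinner y (f3 u) - pinner z (f3 u) * pinner y (f4 u)"
  by (subst frame_expansion[OF assms, of z])
    (simp add: pinner_simps pinner_commute[of _ y])

text \<open>The products of \<open>e1\<close> and \<open>e2\<close> make \<open>f1 u\<close> and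
  \<open>f2 u\<close> linearly independent, so by dimension they span the coordinate plane.\<close>

lemma tangent_expansion:
  assumes "u \<in> W"
  shows "v = - pinner (dd X v u) (e2 u) *\<^sub>R f1 u - pinner (dd X v u) (e1 u) *\<^sub>R f2 u"
proof -
  note lin = dd_linear[OF diff[OF smooth_X assms]]
  define T where "T k = k$1 *\<^sub>R f1 u + k$2 *\<^sub>R f2 u" for k :: "real^2"
  have T: "pinner (dd X (T k) u) (e2 u) = - k$1" "pinner (dd X (T k) u) (e1 u) = - k$2" for k
    using gram[OF assms] by (simp_all add: T_def pinner_simps lin along_def)
  have "linear T"
    by (intro linearI) (simp_all add: T_def algebra_simps)
  moreover have "inj T"
  proof (rule injI)
    fix k l assume eq: "T k = T l"
    have "k$1 = l$1" "k$2 = l$2"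
      using T[of k, unfolded eq] T[of l] by simp_all
    then show "k = l" by (simp add: vec_eq_iff forall_2)
  qed
  ultimately have "surj T" by (rule linear_injective_imp_surjective) simp
  then obtain k where "v = T k" by (metis surjD)
  then show ?thesis using T[of k] by (simp add: T_def)
qed

lemma dX_expansion:
  assumes "u \<in> W"
  shows "dd X v u = - pinner (dd X v u) (e2 u) *\<^sub>R e1 u - pinner (dd X v u) (e1 u) *\<^sub>R e2 u"
  using frame_expansion[OF assms, of "dd X v u"] dX_orth[OF assms] dX_normal[OF assms] by simp

text \<open>A normal vector has no components along \<open>X\<close>, \<open>e1\<close>,
  \<open>e2\<close>, so its products with \<open>f3\<close> and \<open>f4\<close> determine it; this
  yields the uniqueness that the definite description demands.\<close>

lemma normal_proj_eq:
  assumes u: "u \<in> W"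
  shows "normal_proj X u z = - pinner z (f4 u) *\<^sub>R f3 u - pinner z (f3 u) *\<^sub>R f4 u"
proof -
  let ?n = "- pinner z (f4 u) *\<^sub>R f3 u - pinner z (f3 u) *\<^sub>R f4 u"
  have f: "f3 u \<in> normal_space X u" "f4 u \<in> normal_space X u"
    using frame u by (auto simp: null_frame_def)
  then have n: "?n \<in> normal_space X u"
    by (auto simp: normal_space_def pinner_simps)
  have exp: "\<zeta> = - pinner \<zeta> (f4 u) *\<^sub>R f3 u - pinner \<zeta> (f3 u) *\<^sub>R f4 u" if "\<zeta> \<in> normal_space X u" for \<zeta>
    using that frame_expansion[OF u, of \<zeta>] by (auto simp: normal_space_def along_def)
  show ?thesis unfolding normal_proj_def
  proof (rule the_equality)
    show "?n \<in> normal_space X u \<and> (\<forall>\<zeta>\<in>normal_space X u. pinner (z - ?n) \<zeta> = 0)"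
    proof (intro conjI n ballI)
      fix \<zeta> assume "\<zeta> \<in> normal_space X u"
      show "pinner (z - ?n) \<zeta> = 0"
        by (subst exp[OF \<open>\<zeta> \<in> _\<close>]) (simp add: pinner_simps gram[OF u] algebra_simps)
    qed
  next
    fix \<eta> assume *: "\<eta> \<in> normal_space X u \<and> (\<forall>\<zeta>\<in>normal_space X u. pinner (z - \<eta>) \<zeta> = 0)"
    then have "pinner \<eta> (f3 u) = pinner z (f3 u)" "pinner \<eta> (f4 u) = pinner z (f4 u)"
      using f by (auto simp: pinner_simps)
    then show "\<eta> = ?n" using exp[of \<eta>] * by simp
  qed
qed

section \<open>The intrinsic curvature and the normal curvature\<close>

lemma dd_first_ff:
  assumes u: "u \<in> W"
  shows "dd (\<lambda>u. first_ff X u w y) v u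
    = pinner (dd (dd X w) v u) (dd X y u) + pinner (dd X w u) (dd (dd X y) v u)"
  unfolding first_ff_def by (intro dd_pinner diff[OF smooth_on_dd[OF smooth_X] u])

lemmas dX_linear = dd_linear[OF diff[OF smooth_X]]

text \<open>By symmetry of second derivatives the Koszul terms collapse to twice one product. Hence
  the Christoffel symbol is the tangential part of the second derivative of \<open>X\<close>, in
  coordinates.\<close>

lemma christoffel_explicit:
  assumes u: "u \<in> W"
  shows "christoffel X u v w
    = - pinner (dd (dd X w) v u) (e2 u) *\<^sub>R f1 u - pinner (dd (dd X w) v u) (e1 u) *\<^sub>R f2 u" (is "_ = ?z")
    and "first_ff X u (christoffel X u v w) y = pinner (dd (dd X w) v u) (dd X y u)"
proof -
  note c = dd_commute[OF open_W smooth_X u]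
  have z: "first_ff X u ?z y = pinner (dd (dd X w) v u) (dd X y u)" for y
  proof -
    have "dd X ?z u = - pinner (dd (dd X w) v u) (e2 u) *\<^sub>R e1 u - pinner (dd (dd X w) v u) (e1 u) *\<^sub>R e2 u"
      by (simp add: linear_diff[OF linear_frechet_derivative[OF diff[OF smooth_X u]]]
        linear_neg[OF linear_frechet_derivative[OF diff[OF smooth_X u]]] dX_linear[OF u] along_def)
    moreover have "pinner (dd (dd X w) v u) (dd X y u)
       = - pinner (dd X y u) (e2 u) * pinner (dd (dd X w) v u) (e1 u)
         - pinner (dd X y u) (e1 u) * pinner (dd (dd X w) v u) (e2 u)"
      by (subst dX_expansion[OF u, of y]) (simp add: pinner_simps)
    ultimately show ?thesis
      by (simp add: first_ff_def pinner_simps pinner_commute[of _ "dd X y u"])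
  qed
  have koszul: "dd (\<lambda>u. first_ff X u w y) v u + dd (\<lambda>u. first_ff X u v y) w u - dd (\<lambda>u. first_ff X u v w) y u
      = 2 * pinner (dd (dd X w) v u) (dd X y u)" for y
    by (simp add: dd_first_ff[OF u] c[of v w] c[of y w] c[of y v] pinner_commute)
  show *: "christoffel X u v w = ?z"
    unfolding christoffel_def
  proof (rule the_equality)
    show "\<forall>y. 2 * first_ff X u ?z y = dd (\<lambda>u. first_ff X u w y) v u
        + dd (\<lambda>u. first_ff X u v y) w u - dd (\<lambda>u. first_ff X u v w) y u"
      unfolding koszul z by simp
  next
    fix z' assume "\<forall>y. 2 * first_ff X u z' y = dd (\<lambda>u. first_ff X u w y) v u
        + dd (\<lambda>u. first_ff X u v y) w u - dd (\<lambda>u. first_ff X u v w) y u"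
    then have "first_ff X u z' y = pinner (dd (dd X w) v u) (dd X y u)" for y
      by (simp add: koszul)
    from this[of "f1 u"] this[of "f2 u"] tangent_expansion[OF u, of z']
    show "z' = ?z" by (simp add: first_ff_def along_def)
  qed
  show "first_ff X u (christoffel X u v w) y = pinner (dd (dd X w) v u) (dd X y u)"
    unfolding * by (rule z)
qed

lemmas first_ff_christoffel = christoffel_explicit(2)

lemma smooth_christoffel: "smooth_on W (\<lambda>u. christoffel X u v w)"
proof (rule smooth_on_cong[OF open_W christoffel_explicit(1)[symmetric]])
  show "smooth_on W (\<lambda>u. - pinner (dd (dd X w) v u) (e2 u) *\<^sub>R f1 u - pinner (dd (dd X w) v u) (e1 u) *\<^sub>R f2 u)"
    unfolding diff_conv_add_uminus
    by (intro smooth_on_add smooth_on_scaleR smooth_on_minus pinner.smooth_on_prod smooth_on_dd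
        smooth_X smooth open_W)
qed

text \<open>Constant fields have bracket 0; this removes the bracket term from their
  curvature.\<close>

lemma christoffel_zero: "u \<in> W \<Longrightarrow> christoffel X u 0 w = 0"
  by (simp add: christoffel_explicit(1) linear_0[OF linear_frechet_derivative]
      diff[OF smooth_on_dd[OF smooth_X]] pinner_simps)

text \<open>Unlike \<^const>\<open>second_ff\<close>, this keeps the component along the position vector, i.e. it is the
  second fundamental form in the flat ambient space.\<close>

definition II :: "real^2 \<Rightarrow> real^2 \<Rightarrow> real^2 \<Rightarrow> real^5" where
  "II v w u = dd (dd X w) v u - along X (\<lambda>u. christoffel X u v w) u"

lemma smooth_II: "smooth_on W (II v w)"
proof -
  have "smooth_on W (\<lambda>u. dd (dd X w) v u + - along X (\<lambda>u. christoffel X u v w) u)"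
    by (intro smooth_on_add smooth_on_minus smooth_on_along smooth_on_dd smooth_christoffel smooth_X open_W)
  then show ?thesis by (simp add: II_def[abs_def])
qed

lemma II_tangent: "u \<in> W \<Longrightarrow> pinner (II v w u) (dd X y u) = 0"
  using first_ff_christoffel[of u v w y] by (simp add: II_def pinner_simps along_def first_ff_def)

lemma ddX_X:
  assumes "u \<in> W"
  shows "pinner (dd (dd X w) v u) (X u) = - pinner (dd X w u) (dd X v u)"
  by (rule pinner_dd_const[OF open_W assms smooth_on_dd[OF smooth_X] smooth_X dX_orth])

text \<open>The component along \<open>X\<close> comes from differentiating the orthogonality of
  \<open>X\<close> and its derivatives; it later contributes the curvature of the
  pseudosphere.\<close>

lemma II_expansion:
  assumes u: "u \<in> W"
  shows "II v w u = - pinner (dd X v u) (dd X w u) *\<^sub>R X u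
    - pinner (dd (dd X w) v u) (f4 u) *\<^sub>R f3 u - pinner (dd (dd X w) v u) (f3 u) *\<^sub>R f4 u"
proof -
  have "pinner (II v w u) (e1 u) = 0" "pinner (II v w u) (e2 u) = 0"
    using II_tangent[OF u] by (simp_all add: along_def)
  moreover have "pinner (II v w u) (X u) = - pinner (dd X v u) (dd X w u)"
    by (simp add: II_def along_def pinner_simps dX_orth[OF u] ddX_X[OF u] pinner_commute[of "dd X w u"])
  moreover have "pinner (II v w u) (f3 u) = pinner (dd (dd X w) v u) (f3 u)"
     "pinner (II v w u) (f4 u) = pinner (dd (dd X w) v u) (f4 u)"
    by (simp_all add: II_def along_def pinner_simps dX_normal[OF u])
  ultimately show ?thesis
    using frame_expansion[OF u, of "II v w u"] by simp
qed

text \<open>The second derivative of \<open>X\<close> is \<open>II\<close> plus the image of the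
  Christoffel field. The tangential derivative of that image is the iterated covariant derivative,
  and orthogonality moves the derivative off \<open>II\<close>.\<close>

lemma first_ff_levi_civita2:
  assumes u: "u \<in> W"
  shows "first_ff X u (levi_civita X (\<lambda>_. v) (levi_civita X (\<lambda>_. w) (\<lambda>_. z)) u) y
    = pinner (dd (dd (dd X z) w) v u) (dd X y u) + pinner (II w z u) (dd (dd X y) v u)"
proof -
  let ?\<Gamma> = "\<lambda>u. christoffel X u w z"
  have "levi_civita X (\<lambda>_. w) (\<lambda>_. z) = ?\<Gamma>"
    by (simp add: levi_civita_def fun_eq_iff)
  then have "first_ff X u (levi_civita X (\<lambda>_. v) (levi_civita X (\<lambda>_. w) (\<lambda>_. z)) u) y
    = first_ff X u (dd ?\<Gamma> v u) y + first_ff X u (christoffel X u v (?\<Gamma> u)) y"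
    by (simp add: levi_civita_def first_ff_def dX_linear[OF u] pinner_simps)
  also have "\<dots> = pinner (dd (along X ?\<Gamma>) v u) (dd X y u)"
    by (simp add: dd_along[OF open_W u smooth_X smooth_christoffel] first_ff_christoffel[OF u] pinner_simps)
      (simp add: first_ff_def)
  also have "\<dots> = pinner (dd (dd (dd X z) w) v u) (dd X y u) - pinner (dd (II w z) v u) (dd X y u)"
  proof -
    have "dd (dd (dd X z) w) v u = dd (\<lambda>u. II w z u + along X ?\<Gamma> u) v u"
      by (simp add: II_def)
    also have "\<dots> = dd (II w z) v u + dd (along X ?\<Gamma>) v u"
      by (intro dd_add diff[OF _ u] smooth_II smooth_on_along open_W smooth_X smooth_christoffel)
    finally show ?thesis by (simp add: pinner_simps)
  qed
  also have "pinner (dd (II w z) v u) (dd X y u) = - pinner (II w z u) (dd (dd X y) v u)"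
    by (rule pinner_dd_const[OF open_W u smooth_II smooth_on_dd[OF smooth_X] II_tangent])
  finally show ?thesis by simp
qed

text \<open>The Gauss equation in the flat ambient space: third derivatives of \<open>X\<close>
  cancel by symmetry.\<close>

lemma riemann4_gauss:
  assumes u: "u \<in> W"
  shows "riemann4 X u v w z y = pinner (II w z u) (dd (dd X y) v u) - pinner (II v z u) (dd (dd X y) w u)"
proof -
  have "levi_civita X (lie_bracket (\<lambda>_. v) (\<lambda>_. w)) (\<lambda>_. z) u = 0"
    by (simp add: levi_civita_def lie_bracket_def christoffel_zero[OF u])
  then have "riemann4 X u v w z y =
      first_ff X u (levi_civita X (\<lambda>_. v) (levi_civita X (\<lambda>_. w) (\<lambda>_. z)) u) y
    - first_ff X u (levi_civita X (\<lambda>_. w) (levi_civita X (\<lambda>_. v) (\<lambda>_. z)) u) y"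
    by (simp add: riemann4_def riemann_def first_ff_def pinner_simps
        linear_diff[OF linear_frechet_derivative[OF diff[OF smooth_X u]]])
  then show ?thesis
    by (simp add: first_ff_levi_civita2[OF u] dd_commute[OF open_W smooth_on_dd[OF smooth_X] u, of z v w])
qed

section \<open>Normal parts of second derivatives and minimality\<close>

lemma dd_along_normal:
  assumes u: "u \<in> W" and f: "smooth_on W f"
  shows "pinner (dd (along X f) v u) (f3 u) = pinner (dd (dd X (f u)) v u) (f3 u)"
    "pinner (dd (along X f) v u) (f4 u) = pinner (dd (dd X (f u)) v u) (f4 u)"
  by (simp_all add: dd_along[OF open_W u smooth_X f] pinner_simps dX_normal[OF u])

text \<open>That the matrix \<open>?B\<close> is a left inverse of the metric is
  \<open>tangent_expansion\<close> for the coordinate vectors.\<close>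

lemma matrix_inv_first_ff:
  assumes u: "u \<in> W"
  shows "matrix_inv (\<chi> i j. first_ff X u (axis i 1) (axis j 1)) $ i $ j = - f1 u $ i * f2 u $ j - f2 u $ i * f1 u $ j"
proof -
  let ?G = "(\<chi> i j. first_ff X u (axis i 1) (axis j 1)) :: real^2^2"
  let ?B = "(\<chi> i j. - f1 u $ i * f2 u $ j - f2 u $ i * f1 u $ j) :: real^2^2"
  have e: "dd X (g u) u = (g u $ 1) *\<^sub>R dd X (axis 1 1) u + (g u $ 2) *\<^sub>R dd X (axis 2 1) u" for g
  proof -
    have "g u = (g u $ 1) *\<^sub>R axis 1 1 + (g u $ 2) *\<^sub>R axis 2 1"
      by (simp add: vec_eq_iff forall_2 axis_def)
    then show ?thesis by (metis dX_linear[OF u])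
  qed
  have BG: "?B ** ?G = mat 1"
  proof -
    have "(?B ** ?G) $ i $ j = mat 1 $ i $ j" for i j
    proof -
      have "(?B ** ?G) $ i $ j = - f1 u $ i * pinner (e2 u) (dd X (axis j 1) u)
          - f2 u $ i * pinner (e1 u) (dd X (axis j 1) u)"
        by (simp add: matrix_matrix_mult_def sum_2 along_def e[of f1] e[of f2] pinner_simps first_ff_def
          algebra_simps)
      also have "\<dots> = (- pinner (dd X (axis j 1) u) (e2 u) *\<^sub>R f1 u - pinner (dd X (axis j 1) u) (e1 u) *\<^sub>R f2 u) $ i"
        by (simp add: pinner_commute)
      also have "\<dots> = axis j 1 $ i"
        by (simp only: tangent_expansion[OF u, of "axis j 1", symmetric])
      finally show ?thesis by (simp add: mat_def axis_def)
    qed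
    then show ?thesis by (simp add: vec_eq_iff)
  qed
  then have GB: "?G ** ?B = mat 1" by (simp only: matrix_left_right_inverse)
  \<comment> \<open>\<open>matrix_inv\<close> chooses some two-sided inverse, so its defining
    property rests on the existence of one.\<close>
  with BG have inv: "matrix_inv ?G ** ?G = mat 1"
    unfolding matrix_inv_def by (metis (mono_tags, lifting) someI)
  have "matrix_inv ?G = matrix_inv ?G ** (?G ** ?B)" by (simp only: GB matrix_mul_rid)
  also have "\<dots> = ?B" by (simp only: matrix_mul_assoc inv matrix_mul_lid)
  finally have "matrix_inv ?G = ?B" .
  then show ?thesis by simp
qed

text \<open>The trace of \<open>h\<close> over the inverse metric is \<open>-2 h(f1, f2)\<close>, so
  the mean curvature vector is \<open>- h(f1, f2)\<close>.\<close>

lemma mixed_second_derivative: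
  assumes u: "u \<in> W"
  shows "pinner (dd (dd X (f2 u)) (f1 u) u) (f3 u) = 0" "pinner (dd (dd X (f2 u)) (f1 u) u) (f4 u) = 0"
proof -
  let ?X = "\<lambda>i j. dd (dd X (axis j 1)) (axis i 1) u"
  have sym: "dd (dd X v) w u = dd (dd X w) v u" for v w
    by (rule dd_commute[OF open_W smooth_X u])
  \<comment> \<open>\<open>dd_linear\<close> gives linearity in the outer direction; exchanging the
    derivatives carries it to the inner one.\<close>
  have lin: "dd (dd X (v + v')) w u = dd (dd X v) w u + dd (dd X v') w u"
    "dd (dd X (r *\<^sub>R v)) w u = r *\<^sub>R dd (dd X v) w u" for v v' w r
    by (simp_all only: sym[of _ w] dd_linear[OF diff[OF smooth_on_dd[OF smooth_X] u]])
  have e: "v = (v $ 1) *\<^sub>R axis 1 1 + (v $ 2) *\<^sub>R axis 2 1" for v :: "real^2"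
    by (simp add: vec_eq_iff forall_2 axis_def)
  have bil: "dd (dd X v) w u = (v$1 * w$1) *\<^sub>R ?X 1 1 + (v$1 * w$2) *\<^sub>R ?X 2 1
      + (v$2 * w$1) *\<^sub>R ?X 1 2 + (v$2 * w$2) *\<^sub>R ?X 2 2" for v w
  proof -
    have "dd (dd X v) w u = (v$1) *\<^sub>R dd (dd X (axis 1 1)) w u + (v$2) *\<^sub>R dd (dd X (axis 2 1)) w u"
      by (subst e[of v]) (simp only: lin)
    moreover have "dd (dd X v') w u = (w$1) *\<^sub>R dd (dd X v') (axis 1 1) u + (w$2) *\<^sub>R dd (dd X v') (axis 2 1) u" for v'
      by (subst e[of w]) (simp only: dd_linear[OF diff[OF smooth_on_dd[OF smooth_X] u]])
    ultimately show ?thesis by (simp add: algebra_simps)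
  qed
  have "pinner (mean_curvature X u) \<xi> = - pinner (dd (dd X (f2 u)) (f1 u) u) \<xi>"
    if \<xi>: "\<And>v w. pinner (second_ff X u v w) \<xi> = pinner (dd (dd X w) v u) \<xi>" for \<xi>
    by (simp add: mean_curvature_def Let_def matrix_inv_first_ff[OF u] sum_2 pinner_simps \<xi>
        bil[of "f2 u" "f1 u"] sym[of "axis 1 1" "axis 2 1"])
      (simp add: algebra_simps)
  then show "pinner (dd (dd X (f2 u)) (f1 u) u) (f3 u) = 0" "pinner (dd (dd X (f2 u)) (f1 u) u) (f4 u) = 0"
    using minimal[OF u]
    by (simp_all add: second_ff_def normal_proj_eq[OF u] pinner_simps gram[OF u])
qed

section \<open>The normal connection and its curvature\<close>

lemma normal_conn_f3:
  assumes u: "u \<in> W"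
  shows "normal_conn X V f3 u = conn_form f3 f4 (V u) u *\<^sub>R f3 u"
proof -
  \<comment> \<open>As \<open>f3\<close> stays null, its derivative has no component along
    \<open>f4\<close>, so the normal connection only rescales \<open>f3\<close>.\<close>
  have "pinner (dd f3 (V u) u) (f3 u) = - pinner (f3 u) (dd f3 (V u) u)"
    by (rule pinner_dd_const[OF open_W u]) (auto simp: smooth gram)
  then show ?thesis
    by (simp add: normal_conn_def normal_proj_eq[OF u] conn_form_def pinner_commute)
qed

lemma normal_proj_add: "u \<in> W \<Longrightarrow> normal_proj X u (y + z) = normal_proj X u y + normal_proj X u z"
  and normal_proj_scaleR: "u \<in> W \<Longrightarrow> normal_proj X u (r *\<^sub>R y) = r *\<^sub>R normal_proj X u y"
  by (simp_all add: normal_proj_eq pinner_simps algebra_simps)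

lemma normal_conn_conn_f3:
  assumes u: "u \<in> W" and V: "smooth_on W V"
  shows "normal_conn X Y (normal_conn X V f3) u
    = (conn_form f3 f4 (dd V (Y u) u) u + dd (conn_form f3 f4 (V u)) (Y u) u
       + conn_form f3 f4 (V u) u * conn_form f3 f4 (Y u) u) *\<^sub>R f3 u"
proof -
  \<comment> \<open>The normal connection form on the field \<open>V\<close>, with direction and
    point moving together; \<open>dd (conn_form f3 f4 (V u))\<close> freezes the direction.\<close>
  define g where "g u = - pinner (along f3 V u) (f4 u)" for u
  have V3: "smooth_on W (along f3 V)"
    by (intro smooth_on_along open_W smooth V)
  have smg: "smooth_on W g"
    unfolding g_def by (intro smooth_on_minus pinner.smooth_on_prod open_W smooth V3)
  have "dd (\<lambda>u. g u *\<^sub>R f3 u) (Y u) u = dd (normal_conn X V f3) (Y u) u"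
    by (rule dd_cong(1)[OF open_W u diff[OF smooth_on_scaleR[OF open_W smg smooth(3)] u]])
      (simp add: normal_conn_f3 g_def conn_form_def along_def)
  then have "normal_conn X Y (normal_conn X V f3) u = normal_proj X u (dd (\<lambda>u. g u *\<^sub>R f3 u) (Y u) u)"
    by (simp add: normal_conn_def[of _ Y])
  also have "\<dots> = dd g (Y u) u *\<^sub>R normal_proj X u (f3 u) + g u *\<^sub>R normal_proj X u (dd f3 (Y u) u)"
    by (simp add: dd_scaleR diff[OF smg u] diff[OF smooth(3) u] normal_proj_add[OF u] normal_proj_scaleR[OF u])
  also have "normal_proj X u (f3 u) = f3 u"
    by (simp add: normal_proj_eq[OF u] gram[OF u])
  also have "normal_proj X u (dd f3 (Y u) u) = conn_form f3 f4 (Y u) u *\<^sub>R f3 u"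
    using normal_conn_f3[OF u, of Y] by (simp add: normal_conn_def)
  also have "dd g (Y u) u = conn_form f3 f4 (dd V (Y u) u) u + dd (conn_form f3 f4 (V u)) (Y u) u"
  proof -
    have "dd g (Y u) u = - pinner (dd (along f3 V) (Y u) u) (f4 u) - pinner (along f3 V u) (dd f4 (Y u) u)"
      unfolding g_def
      by (subst dd_minus) (auto simp: dd_pinner diff[OF _ u] smooth V3
          intro!: diff[OF _ u] pinner.smooth_on_prod open_W)
    moreover have "dd (conn_form f3 f4 (V u)) (Y u) u
        = - pinner (dd (dd f3 (V u)) (Y u) u) (f4 u) - pinner (along f3 V u) (dd f4 (Y u) u)"
      unfolding conn_form_def along_def
      by (subst dd_minus) (auto simp: dd_pinner diff[OF _ u] smooth smooth_on_dd
          intro!: diff[OF _ u] pinner.smooth_on_prod open_W)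
    ultimately show ?thesis
      by (simp add: dd_along[OF open_W u smooth(3) V] pinner_simps) (simp add: conn_form_def)
  qed
  also have "g u = conn_form f3 f4 (V u) u"
    by (simp add: g_def conn_form_def along_def)
  finally show ?thesis by (simp add: algebra_simps)
qed

text \<open>The connection acts on \<open>f3\<close> by a scalar form, so quadratic terms cancel in
  the commutator. Derivatives of \<open>f1\<close> and \<open>f2\<close> cancel against the bracket,
  and the exterior derivative of the form remains.\<close>

lemma normal_riemann_eq:
  assumes u: "u \<in> W"
  shows "- pinner (normal_riemann X f1 f2 f3 u) (f4 u)
    = dd (conn_form f3 f4 (f2 u)) (f1 u) u - dd (conn_form f3 f4 (f1 u)) (f2 u) u"
proof -
  have "conn_form f3 f4 (lie_bracket f1 f2 u) u
      = conn_form f3 f4 (dd f2 (f1 u) u) u - conn_form f3 f4 (dd f1 (f2 u) u) u"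
    by (simp add: lie_bracket_def conn_form_def pinner_simps
        linear_diff[OF linear_frechet_derivative[OF diff[OF smooth(3) u]]])
  then show ?thesis
    unfolding normal_riemann_def
    by (simp add: normal_conn_conn_f3[OF u] smooth normal_conn_f3[OF u, of "lie_bracket f1 f2"]
        pinner_simps gram[OF u])
qed

end

section \<open>Structure equations\<close>

text \<open>With \<open>a\<close>, \<open>b\<close>, \<open>c\<close>, \<open>d\<close> the values of \<open>coef\<close> at \<open>f1 f4\<close>, \<open>f1 f3\<close>, \<open>f2 f4\<close>, \<open>f2 f3\<close> one has
  \<open>h(f1, f1) = a f3 + b f4\<close> and \<open>h(f2, f2) = c f3 + d f4\<close>: the frame is null, so the component along
  \<open>f3\<close> is minus the product with \<open>f4\<close>.\<close>

definition coef :: "(real^2 \<Rightarrow> real^5) \<Rightarrow> (real^2 \<Rightarrow> real^2) \<Rightarrow> (real^2 \<Rightarrow> real^5) \<Rightarrow> real^2 \<Rightarrow> real" where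
  "coef X f g u = conn_form (along X f) g (f u) u"

context minimal_null_frame
begin

abbreviation "\<omega> \<equiv> conn_form e1 e2"
abbreviation "\<phi> \<equiv> conn_form f3 f4"
abbreviation "\<theta>1 \<equiv> conn_form X e2"
abbreviation "\<theta>2 \<equiv> conn_form X e1"

section \<open>The dual coframe and the derivatives of the frame\<close>

lemma coframe:
  assumes "u \<in> W"
  shows "\<theta>1 (f1 u) u = 1" "\<theta>1 (f2 u) u = 0" "\<theta>2 (f1 u) u = 0" "\<theta>2 (f2 u) u = 1"
  using gram[OF assms] by (simp_all add: conn_form_def along_def)

lemma coframe_expansion: "u \<in> W \<Longrightarrow> v = \<theta>1 v u *\<^sub>R f1 u + \<theta>2 v u *\<^sub>R f2 u"
  using tangent_expansion[of u v] by (simp add: conn_form_def)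

text \<open>Minimality makes both forms vanish on \<open>f2\<close>, so they are multiples of
  \<open>\<theta>1\<close>.\<close>

lemma conn_form_e1_normal:
  assumes u: "u \<in> W"
  shows "conn_form e1 f3 v u = coef X f1 f3 u * \<theta>1 v u" "conn_form e1 f4 v u = coef X f1 f4 u * \<theta>1 v u"
proof -
  have "conn_form e1 f3 (f2 u) u = 0" "conn_form e1 f4 (f2 u) u = 0"
    by (simp_all add: conn_form_def dd_along_normal[OF u] smooth mixed_second_derivative[OF u]
        dd_commute[OF open_W smooth_X u, of "f1 u"])
  moreover have "conn_form e1 g v u = \<theta>1 v u * conn_form e1 g (f1 u) u + \<theta>2 v u * conn_form e1 g (f2 u) u" for g
    by (subst coframe_expansion[OF u, of v]) (simp only: conn_form_linear[OF smooth(5) u])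
  ultimately show "conn_form e1 f3 v u = coef X f1 f3 u * \<theta>1 v u"
    "conn_form e1 f4 v u = coef X f1 f4 u * \<theta>1 v u"
    by (simp_all add: coef_def)
qed

lemma conn_form_e2_normal:
  assumes u: "u \<in> W"
  shows "conn_form e2 f3 v u = coef X f2 f3 u * \<theta>2 v u" "conn_form e2 f4 v u = coef X f2 f4 u * \<theta>2 v u"
  using minimal_null_frame.conn_form_e1_normal[OF swap_tangent u] by simp_all

lemma conn_form_swap:
  assumes u: "u \<in> W" and e: "smooth_on W e" "smooth_on W e'" and c: "\<And>u. u \<in> W \<Longrightarrow> pinner (e u) (e' u) = c"
  shows "conn_form e' e v u = - conn_form e e' v u"
  using pinner_dd_const[OF open_W u e c] by (simp add: conn_form_def pinner_commute)

text \<open>The whole connection matrix, filled in by skew symmetry. Together with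
  \<open>pinner_frame\<close> it reduces the structure equations to calculations.\<close>

lemma frame_derivatives:
  assumes u: "u \<in> W"
  shows "pinner (dd X v u) (X u) = 0" "pinner (dd X v u) (e1 u) = - \<theta>2 v u" "pinner (dd X v u) (e2 u) = - \<theta>1 v u"
    "pinner (dd X v u) (f3 u) = 0" "pinner (dd X v u) (f4 u) = 0"
    "pinner (dd e1 v u) (X u) = \<theta>2 v u" "pinner (dd e1 v u) (e1 u) = 0" "pinner (dd e1 v u) (e2 u) = - \<omega> v u"
    "pinner (dd e1 v u) (f3 u) = - coef X f1 f3 u * \<theta>1 v u" "pinner (dd e1 v u) (f4 u) = - coef X f1 f4 u * \<theta>1 v u"
    "pinner (dd e2 v u) (X u) = \<theta>1 v u" "pinner (dd e2 v u) (e1 u) = \<omega> v u" "pinner (dd e2 v u) (e2 u) = 0"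
    "pinner (dd e2 v u) (f3 u) = - coef X f2 f3 u * \<theta>2 v u" "pinner (dd e2 v u) (f4 u) = - coef X f2 f4 u * \<theta>2 v u"
    "pinner (dd f3 v u) (X u) = 0" "pinner (dd f3 v u) (e1 u) = coef X f1 f3 u * \<theta>1 v u"
    "pinner (dd f3 v u) (e2 u) = coef X f2 f3 u * \<theta>2 v u"
    "pinner (dd f3 v u) (f3 u) = 0" "pinner (dd f3 v u) (f4 u) = - \<phi> v u"
    "pinner (dd f4 v u) (X u) = 0" "pinner (dd f4 v u) (e1 u) = coef X f1 f4 u * \<theta>1 v u"
    "pinner (dd f4 v u) (e2 u) = coef X f2 f4 u * \<theta>2 v u"
    "pinner (dd f4 v u) (f3 u) = \<phi> v u" "pinner (dd f4 v u) (f4 u) = 0"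
  using dX_orth[OF u, of v] dX_normal(1,2)[OF u, of v] conn_form_e1_normal[OF u, of v] conn_form_e2_normal[OF u, of v]
    conn_form_swap[OF u smooth_X smooth(5) gram(2), where v = v] conn_form_swap[OF u smooth_X smooth(6) gram(3), where v = v]
    conn_form_swap[OF u smooth_X smooth(3) gram(4), where v = v] conn_form_swap[OF u smooth_X smooth(4) gram(5), where v = v]
    conn_form_swap[OF u smooth(5) smooth(6) gram(8), where v = v] conn_form_swap[OF u smooth(3) smooth(4) gram(11), where v = v]
    conn_form_swap[OF u smooth(5) smooth(5) gram(6), where v = v] conn_form_swap[OF u smooth(6) smooth(6) gram(7), where v = v]
    conn_form_swap[OF u smooth(3) smooth(3) gram(9), where v = v] conn_form_swap[OF u smooth(4) smooth(4) gram(10), where v = v]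
    conn_form_swap[OF u smooth(5) smooth(3) gram(12), where v = v] conn_form_swap[OF u smooth(5) smooth(4) gram(13), where v = v]
    conn_form_swap[OF u smooth(6) smooth(3) gram(14), where v = v] conn_form_swap[OF u smooth(6) smooth(4) gram(15), where v = v]
  unfolding pinner_dd by simp_all

section \<open>Codazzi, Gauss and Ricci equations\<close>

lemma smooth_coef: "smooth_on W (coef X f1 f4)"
proof -
  have "coef X f1 f4 = (\<lambda>u. - pinner (along e1 f1 u) (f4 u))"
    by (simp add: coef_def conn_form_def along_def fun_eq_iff)
  then show ?thesis
    by (auto intro!: smooth_on_minus pinner.smooth_on_prod smooth_on_along smooth open_W)
qed

text \<open>The exterior derivative is taken on both sides of
  \<open>conn_form e1 f4 = a \<theta>1\<close>. One \<omega> comes from the left side, the other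
  from the derivative of \<open>\<theta>1\<close>.\<close>

lemma codazzi:
  assumes u: "u \<in> W"
  shows "dd (coef X f1 f4) (f2 u) u = coef X f1 f4 u * (2 * \<omega> (f2 u) u - \<phi> (f2 u) u)"
proof -
  let ?a = "coef X f1 f4"
  have prod: "dd (conn_form e1 f4 w) v u = dd ?a v u * \<theta>1 w u + ?a u * dd (\<theta>1 w) v u" for v w
  proof -
    have "dd (conn_form e1 f4 w) v u = dd (\<lambda>u. ?a u * \<theta>1 w u) v u"
      by (rule dd_cong(1)[OF open_W u]) (auto simp: conn_form_e1_normal
          intro!: diff[OF _ u] smooth_on_conn_form smooth open_W)
    also have "\<dots> = dd ?a v u * \<theta>1 w u + ?a u * dd (\<theta>1 w) v u"
      by (intro dd_mult diff[OF _ u] smooth_coef smooth_on_conn_form smooth smooth_X open_W)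
    finally show ?thesis .
  qed
  have "dd (conn_form e1 f4 (f1 u)) (f2 u) u - dd (conn_form e1 f4 (f2 u)) (f1 u) u
      = ?a u * (\<omega> (f2 u) u - \<phi> (f2 u) u)"
    unfolding d_conn_form[OF open_W u smooth(5,4)] pinner_frame[OF u, of "dd e1 _ u" "dd f4 _ u"]
    by (simp add: frame_derivatives[OF u] coframe[OF u] algebra_simps)
  moreover have "dd (\<theta>1 (f1 u)) (f2 u) u - dd (\<theta>1 (f2 u)) (f1 u) u = - \<omega> (f2 u) u"
    unfolding d_conn_form[OF open_W u smooth_X smooth(6)] pinner_frame[OF u, of "dd X _ u" "dd e2 _ u"]
    by (simp add: frame_derivatives[OF u] coframe[OF u] algebra_simps)
  moreover have "dd (conn_form e1 f4 (f1 u)) (f2 u) u - dd (conn_form e1 f4 (f2 u)) (f1 u) u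
      = dd ?a (f2 u) u + ?a u * (dd (\<theta>1 (f1 u)) (f2 u) u - dd (\<theta>1 (f2 u)) (f1 u) u)"
    unfolding prod by (simp add: coframe[OF u] algebra_simps)
  ultimately show ?thesis by (simp add: algebra_simps)
qed

text \<open>The summand -1 stems from the components along the position vector, that is, from the
  curvature of the pseudosphere.\<close>

lemma d_\<omega>:
  assumes u: "u \<in> W"
  shows "dd (\<omega> (f2 u)) (f1 u) u - dd (\<omega> (f1 u)) (f2 u) u
    = - 1 - coef X f1 f4 u * coef X f2 f3 u - coef X f1 f3 u * coef X f2 f4 u"
  unfolding d_conn_form[OF open_W u smooth(5,6)] pinner_frame[OF u, of "dd e1 _ u" "dd e2 _ u"]
  by (simp add: frame_derivatives[OF u] coframe[OF u] algebra_simps)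

lemma d_\<phi>:
  assumes u: "u \<in> W"
  shows "dd (\<phi> (f2 u)) (f1 u) u - dd (\<phi> (f1 u)) (f2 u) u
    = coef X f1 f4 u * coef X f2 f3 u - coef X f1 f3 u * coef X f2 f4 u"
  unfolding d_conn_form[OF open_W u smooth(3,4)] pinner_frame[OF u, of "dd f3 _ u" "dd f4 _ u"]
  by (simp add: frame_derivatives[OF u] coframe[OF u] algebra_simps)

lemma normal_curvature_eq:
  assumes u: "u \<in> W"
  shows "- pinner (normal_riemann X f1 f2 f3 u) (f4 u)
    = coef X f1 f4 u * coef X f2 f3 u - coef X f1 f3 u * coef X f2 f4 u"
  unfolding normal_riemann_eq[OF u] by (rule d_\<phi>[OF u])

lemma sectional_eq:
  assumes u: "u \<in> W"
  shows "sectional X u (f1 u) (f2 u) = 1 + coef X f1 f4 u * coef X f2 f3 u + coef X f1 f3 u * coef X f2 f4 u"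
proof -
  have h: "pinner (dd (dd X (f1 u)) (f1 u) u) (f3 u) = - coef X f1 f3 u"
    "pinner (dd (dd X (f1 u)) (f1 u) u) (f4 u) = - coef X f1 f4 u"
    "pinner (dd (dd X (f2 u)) (f2 u) u) (f3 u) = - coef X f2 f3 u"
    "pinner (dd (dd X (f2 u)) (f2 u) u) (f4 u) = - coef X f2 f4 u"
    by (simp_all add: coef_def conn_form_def dd_along_normal[OF u] smooth)
  have X: "pinner (X u) (dd (dd X w) v u) = - pinner (dd X w u) (dd X v u)" for v w
    using ddX_X[OF u] by (simp add: pinner_commute)
  have "riemann4 X u (f1 u) (f2 u) (f2 u) (f1 u)
      = - coef X f1 f3 u * coef X f2 f4 u - coef X f1 f4 u * coef X f2 f3 u - 1"
    unfolding riemann4_gauss[OF u] II_expansion[OF u]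
    by (simp add: pinner_simps X pinner_commute[of "f3 u" "dd (dd X _) _ u"]
        pinner_commute[of "f4 u" "dd (dd X _) _ u"] h mixed_second_derivative[OF u]
        dd_commute[OF open_W smooth_X u, of "f1 u" "f2 u"] gram(6-8,20)[OF u, unfolded along_def])
  \<comment> \<open>The frame is null, so the denominator of \<open>sectional\<close> is -1 and
    reverses the sign.\<close>
  then show ?thesis
    using frame u by (simp add: sectional_def null_frame_def)
qed

text \<open>The function \<open>a = coef X f1 f4\<close> has no zeros and satisfies
  \<open>da = a \<tau>\<close>; symmetry of its second derivatives makes
  \<open>\<tau> = 2 \<omega> - \<phi>\<close> closed.\<close>

lemma two_d_\<omega>_eq_d_\<phi>:
  assumes p: "p \<noteq> 0" "\<And>u. u \<in> W \<Longrightarrow> coef X f1 f4 u * coef X f2 f3 u = p" and u: "u \<in> W"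
  shows "2 * (dd (\<omega> w) v u - dd (\<omega> v) w u) = dd (\<phi> w) v u - dd (\<phi> v) w u"
proof -
  \<comment> \<open>Exchanging both null pairs turns \<open>a\<close> into \<open>d\<close> and
    changes the signs of \<omega> and \<phi>.\<close>
  interpret swap: minimal_null_frame X W f2 f1 f4 f3
    by (rule minimal_null_frame.swap_normal[OF swap_tangent])
  let ?a = "coef X f1 f4" and ?d = "coef X f2 f3"
  define \<tau> where "\<tau> v u = 2 * \<omega> v u - \<phi> v u" for v u
  note sm\<omega> = smooth_on_conn_form[OF open_W smooth(5,6)]
  note sm\<phi> = smooth_on_conn_form[OF open_W smooth(3,4)]
  \<comment> \<open>Direction \<open>f2\<close> is Codazzi for \<open>a\<close>; direction
    \<open>f1\<close> follows from Codazzi for \<open>d\<close>, as \<open>a d\<close> is the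
    nonzero constant \<open>p\<close>.\<close>
  have dlog: "dd ?a v u = ?a u * \<tau> v u" if u: "u \<in> W" for u v
  proof -
    have "dd (\<lambda>u. ?a u * ?d u) v u = 0" for v
      using dd_cong(1)[OF open_W u differentiable_const, of p "\<lambda>u. ?a u * ?d u" v] p(2) by simp
    then have "dd ?a (f1 u) u * ?d u + ?a u * dd ?d (f1 u) u = 0"
      by (simp add: dd_mult diff[OF smooth_coef u] diff[OF swap.smooth_coef u])
    moreover have "dd ?d (f1 u) u = - ?d u * \<tau> (f1 u) u"
      using swap.codazzi[OF u] conn_form_swap[OF u smooth(5,6) gram(8), where v = "f1 u"]
        conn_form_swap[OF u smooth(3,4) gram(11), where v = "f1 u"]
      by (simp add: \<tau>_def algebra_simps)
    ultimately have "?d u * dd ?a (f1 u) u = ?d u * (?a u * \<tau> (f1 u) u)"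
      by (simp add: algebra_simps)
    then have 1: "dd ?a (f1 u) u = ?a u * \<tau> (f1 u) u" using p(1) p(2)[OF u] by auto
    have 2: "dd ?a (f2 u) u = ?a u * \<tau> (f2 u) u"
      using codazzi[OF u] by (simp add: \<tau>_def)
    have "dd ?a v u = \<theta>1 v u * dd ?a (f1 u) u + \<theta>2 v u * dd ?a (f2 u) u"
      by (subst coframe_expansion[OF u, of v]) (simp only: dd_linear[OF diff[OF smooth_coef u]] real_scaleR_def)
    moreover have "\<tau> v u = \<theta>1 v u * \<tau> (f1 u) u + \<theta>2 v u * \<tau> (f2 u) u"
      unfolding \<tau>_def by (subst (1 2) coframe_expansion[OF u, of v])
        (simp only: conn_form_linear[OF smooth(5) u] conn_form_linear[OF smooth(3) u], simp add: algebra_simps)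
    ultimately show ?thesis by (simp add: 1 2 algebra_simps)
  qed
  have d\<tau>: "dd (\<tau> w) v u = 2 * dd (\<omega> w) v u - dd (\<phi> w) v u" "\<tau> w differentiable at u" for v w
  proof -
    have eq: "\<tau> w = (\<lambda>u. 2 * \<omega> w u + - \<phi> w u)" by (simp add: \<tau>_def fun_eq_iff)
    have d: "(\<lambda>u. 2 * \<omega> w u) differentiable at u" "(\<lambda>u. - \<phi> w u) differentiable at u"
      by (auto intro!: differentiable_minus diff[OF sm\<omega> u] diff[OF sm\<phi> u])
    show "\<tau> w differentiable at u" unfolding eq by (intro differentiable_add d)
    show "dd (\<tau> w) v u = 2 * dd (\<omega> w) v u - dd (\<phi> w) v u"
      unfolding eq dd_add[OF d] by (simp add: dd_mult dd_minus diff[OF sm\<omega> u] diff[OF sm\<phi> u])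
  qed
  \<comment> \<open>By \<open>dlog\<close> the first term is \<open>a \<tau>(v) \<tau>(w)\<close>,
    which is symmetric in \<open>v\<close> and \<open>w\<close>.\<close>
  have "dd (dd ?a w) v u = dd ?a v u * \<tau> w u + ?a u * dd (\<tau> w) v u" for v w
  proof -
    have "dd (dd ?a w) v u = dd (\<lambda>u. ?a u * \<tau> w u) v u"
      by (rule dd_cong(1)[OF open_W u diff[OF smooth_on_dd[OF smooth_coef] u] dlog])
    then show ?thesis by (simp add: dd_mult diff[OF smooth_coef u] d\<tau>(2))
  qed
  then have "?a u * dd (\<tau> w) v u = ?a u * dd (\<tau> v) w u"
    using dd_commute[OF open_W smooth_coef u, of w v] dlog[OF u] by (simp add: algebra_simps)
  then have "dd (\<tau> w) v u = dd (\<tau> v) w u" using p(1) p(2)[OF u] by auto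
  then show ?thesis by (simp add: d\<tau>)
qed

lemma constant_curvatures:
  assumes K: "\<And>u. u \<in> W \<Longrightarrow> sectional X u (f1 u) (f2 u) = k"
    and KD: "\<And>u. u \<in> W \<Longrightarrow> - pinner (normal_riemann X f1 f2 f3 u) (f4 u) = n"
    and n: "n \<noteq> 0" and u: "u \<in> W"
  shows "k = 1/3 \<and> \<bar>n\<bar> = 2/3"
proof -
  interpret swap: minimal_null_frame X W f1 f2 f4 f3
    by (rule swap_normal)
  \<comment> \<open>Half the sum and half the difference of the Gauss and Ricci equations give the
    two products.\<close>
  have ad: "coef X f1 f4 u * coef X f2 f3 u = (k - 1 + n) / 2" if "u \<in> W" for u
    using K[OF that] KD[OF that] sectional_eq[OF that] normal_curvature_eq[OF that] by simp
  have bc: "coef X f1 f3 u * coef X f2 f4 u = (k - 1 - n) / 2" if "u \<in> W" for u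
    using K[OF that] KD[OF that] sectional_eq[OF that] normal_curvature_eq[OF that] by simp
  have 1: "n = - 2 * k" if "k - 1 + n \<noteq> 0"
    using two_d_\<omega>_eq_d_\<phi>[OF _ ad u, of "f2 u" "f1 u"] that d_\<omega>[OF u] d_\<phi>[OF u] ad[OF u] bc[OF u]
    by (simp add: field_simps)
  \<comment> \<open>Exchanging \<open>f3\<close> and \<open>f4\<close> interchanges the products and
    reverses the sign of \<phi>.\<close>
  have 2: "n = 2 * k" if "k - 1 - n \<noteq> 0"
    using swap.two_d_\<omega>_eq_d_\<phi>[OF _ bc u, of "f2 u" "f1 u"] that swap.d_\<omega>[OF u] swap.d_\<phi>[OF u] ad[OF u] bc[OF u]
    by (simp add: field_simps)
  show ?thesis
  \<comment> \<open>If \<open>ad\<close> vanishes, then \<open>bc = - n\<close> is nonzero.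
    Otherwise \<open>n = - 2 k\<close>, and a nonzero \<open>bc\<close> would force
    \<open>n = 0\<close>.\<close>
  proof (cases "k - 1 + n = 0")
    case True
    with n 2 have "n = 2 * k" by linarith
    with True have "k = 1/3" "n = 2/3" by linarith+
    then show ?thesis by simp
  next
    case False
    then have n': "n = - 2 * k" by (rule 1)
    with n 2 have "k - 1 - n = 0" by linarith
    with n' have "k = 1/3" "n = -2/3" by linarith+
    then show ?thesis by simp
  qed
qed

end

section \<open>From local frames to the surface\<close>

theorem corollary3p6:
  fixes M :: "'m topology" and A :: "'m atlas" and F :: "'m \<Rightarrow> real^5" and K KD :: "'m \<Rightarrow> real"
  assumes "connected_oriented_surface M A"
    and "lorentzian_immersion A F"
    and "minimal_surface A F"
    and "is_gaussian_curvature A F K"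
    and "is_normal_curvature A F KD"
    and "K constant_on topspace M"
    and "KD constant_on topspace M"
    and "\<forall>p\<in>topspace M. KD p \<noteq> 0"
  shows "\<forall>p\<in>topspace M. K p = 1/3 \<and> \<bar>KD p\<bar> = 2/3"
proof
  fix p assume p: "p \<in> topspace M"
  have cover: "(\<Union>(U, x)\<in>A. x ` U) = topspace M"
    using assms(1) by (simp add: connected_oriented_surface_def)
  then obtain U x u where Ux: "(U, x) \<in> A" and u: "u \<in> U" "x u = p"
    using p by (auto simp flip: cover)
  have M: "x w \<in> topspace M" if "w \<in> U" for w
    using Ux that unfolding cover[symmetric] by blast
  \<comment> \<open>The curvatures are constant on the surface, so their values at \<open>p\<close>
    can be found on any neighbourhood carrying a null frame.\<close>
  from bspec[OF bspec[OF assms(5)[unfolded is_normal_curvature_def] Ux, unfolded prod.case] u(1)]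
  obtain W f1 f2 f3 f4 where W: "open W" "u \<in> W" "W \<subseteq> U" and fr: "null_frame (F \<circ> x) W f1 f2 f3 f4"
    and KD: "\<And>w. w \<in> W \<Longrightarrow> KD (x w) = - pinner (normal_riemann (F \<circ> x) f1 f2 f3 w) (f4 w)"
    by blast
  have sm: "smooth_on U (F \<circ> x)" and sph: "\<And>w. w \<in> U \<Longrightarrow> F (x w) \<in> pseudosphere"
    using bspec[OF assms(2)[unfolded lorentzian_immersion_def] Ux] by auto
  interpret minimal_null_frame "F \<circ> x" W f1 f2 f3 f4
  proof
    show "smooth_on W (F \<circ> x)" using smooth_on_subset[OF sm W(3)] .
    show "pinner ((F \<circ> x) w) ((F \<circ> x) w) = 1" if "w \<in> W" for w
      using sph[of w] that W(3) by (auto simp: pseudosphere_def)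
    show "mean_curvature (F \<circ> x) w = 0" if "w \<in> W" for w
      using bspec[OF assms(3)[unfolded minimal_surface_def] Ux] that W(3) by auto
  qed (use W fr in auto)
  \<comment> \<open>\<open>K\<close> is given by \<open>sectional\<close> on spanning pairs, so the
    frame has to be one.\<close>
  have span: "span {f1 w, f2 w} = UNIV" if "w \<in> W" for w
  proof -
    have "v \<in> span {f1 w, f2 w}" for v
      by (subst coframe_expansion[OF that, of v]) (intro span_add span_scale span_base; simp)
    then show ?thesis by auto
  qed
  have "K (x w) = sectional (F \<circ> x) w (f1 w) (f2 w)" if "w \<in> W" for w
    using bspec[OF assms(4)[unfolded is_gaussian_curvature_def] Ux] W(3) that span[OF that] by auto
  moreover have "K (x w) = K p" "KD (x w) = KD p" if "w \<in> W" for w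
    using assms(6,7) M[of w] that W(3) p unfolding constant_on_def by (metis subsetD)+
  ultimately show "K p = 1/3 \<and> \<bar>KD p\<bar> = 2/3"
    using constant_curvatures[of "K p" "KD p" u] KD W(2) assms(8) p by metis
qed

end
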